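(* Let $k\ge 2$ be an integer and let $\delta$ be a fixed positive real number. There is a constant $C=C(\delta,k)>0$ such that the following holds: if $r=r(n)$ satisfies $C n^{1-1/k}\le r\le n$, and $R$ is a subset of $[n]=\{1,\dots,n\}$ chosen uniformly at random among all subsets of cardinality $r$, then the probability that $R$ is $(\delta,(a,a+d^k))$-dense tends to $1$ as $n\to\infty$. That is, with probability $1-o(1)$, every subset $A\subseteq R$ with $|A|\ge \delta |R|$ contains two elements $a$ and $a+d^k$ for some positive integer $d$.
   Context: For a set $A$ of integers and $\delta>0$, $A$ is called $(\delta,(a,a+d^k))$-dense if every subset of $A$ of cardinality at least $\delta|A|$ contains a nontrivial instance of the configuration $(a,a+d^k)$, i.e. two elements $a$ and $a+d^k$ with $d$ a positive integer. "Almost every subset of size $r\gg_\delta n^{1-1/k}$" means: for $r$ at least a sufficiently large constant (depending on $\delta$ and $k$) times $n^{1-1/k}$, the proportion of $r$-element subsets of $[n]$ with the property tends to $1$ as $n\to\infty$. *)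

theory Defs
  imports "HOL-Probability.Probability"
begin

(* Meant for finite A: card of an infinite set is 0. *)
definition power_diff_dense :: "real \<Rightarrow> nat \<Rightarrow> int set \<Rightarrow> bool" where
  "power_diff_dense \<delta> k A \<longleftrightarrow>
     (\<forall>B. B \<subseteq> A \<and> real (card B) \<ge> \<delta> * real (card A) \<longrightarrow>
        (\<exists>a d :: int. d > 0 \<and> a \<in> B \<and> a + d ^ k \<in> B))"

(* Only meaningful for r \<le> n: pmf_of_set is unspecified on the empty set. *)
definition random_subset :: "nat \<Rightarrow> nat \<Rightarrow> int set pmf" where
  "random_subset n r = pmf_of_set {R. R \<subseteq> {1..int n} \<and> card R = r}"

end

theory Submission
  imports Defs "HOL-Computational_Algebra.Polynomial" "HOL-Real_Asymp.Real_Asymp"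
begin

text \<open>
  Density version (Furstenberg, Sarkozy), without Fourier analysis. Let \<open>\<alpha>\<close> be the infimum over
  \<open>n\<close> of the maximal density in \<open>[n]\<close> of a set without \<open>k\<close>-th power differences, and suppose
  \<open>\<alpha> > 0\<close>. An extremal set \<open>A\<close> has density at most \<open>\<alpha> + o(1)\<close> on every progression whose common
  difference is a \<open>k\<close>-th power, hence density about \<open>\<alpha>\<close> on almost all of them. Repeated van der
  Corput differencing reduces averages of \<open>f = 1\<^sub>A - \<alpha>\<close> along \<open>d\<^sup>k\<close> to averages along arithmetic
  progressions, which are small in mean square; so \<open>A\<close> contains about \<open>\<alpha>\<^sup>2\<close> of all pairs
  \<open>(a, a + d\<^sup>k)\<close>, a contradiction.

  Since \<open>k\<close>-th powers are closed under dilation by \<open>k\<close>-th powers, Varnavides' averaging argument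
  upgrades this to: in the graph joining \<open>a\<close> and \<open>a + d\<^sup>k\<close>, every \<open>U \<subseteq> [n]\<close> with
  \<open>|U| \<ge> \<epsilon> n\<close> has a vertex of degree \<open>\<Omega>(n\<^bsup>1/k\<^esup>)\<close> inside \<open>U\<close>. By the Kleitman-Winston algorithm
  each independent set is then contained in \<open>S \<union> C(S)\<close> with \<open>|S| = O(n\<^bsup>1-1/k\<^esup>)\<close> and
  \<open>|C(S)| \<le> \<epsilon> n\<close>, and a union bound over \<open>S\<close> finishes the proof.
\<close>

section \<open>Averages along polynomial sequences\<close>

text \<open>A 1-bounded function on the cyclic group of order \<open>N\<close>, kept as a function
  on the integers so that polynomial shifts can be taken before reduction.\<close>

definition periodic_bdd :: "nat \<Rightarrow> (int \<Rightarrow> real) \<Rightarrow> bool" where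
  "periodic_bdd N F \<longleftrightarrow> N > 0 \<and> (\<forall>x. F (x mod int N) = F x) \<and> (\<forall>x. \<bar>F x\<bar> \<le> 1)"

text \<open>Only progressions whose common difference is a \<open>k\<close>-th power are used, because only on these is
  the absence of \<open>k\<close>-th power differences inherited.\<close>

definition ap_small :: "nat \<Rightarrow> nat \<Rightarrow> nat \<Rightarrow> real \<Rightarrow> nat \<Rightarrow> (int \<Rightarrow> real) \<Rightarrow> bool" where
  "ap_small k Q L \<eta> N F \<longleftrightarrow>
     (\<forall>q\<in>{1..Q}. (\<Sum>x\<in>{0..<int N}. (\<Sum>i<L. F (x + int (q ^ k * i)))\<^sup>2)
        \<le> \<eta> * real L ^ 2 * real N)"

text \<open>The length \<open>L\<close> is quantified after \<open>Q\<close> and \<open>\<eta>\<close>, since it will be the length at which the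
  extremal density is within \<open>\<eta> / 2\<close> of its infimum.\<close>

definition controlled :: "nat \<Rightarrow> (nat \<Rightarrow> int) \<Rightarrow> bool" where
  "controlled k g \<longleftrightarrow> (\<forall>\<epsilon>>0. \<exists>Q. \<exists>\<eta>>0. \<forall>L\<ge>1. \<exists>D\<^sub>0. \<forall>D\<ge>D\<^sub>0. \<forall>N F.
     periodic_bdd N F \<longrightarrow> ap_small k Q L \<eta> N F \<longrightarrow>
     (\<Sum>x\<in>{0..<int N}. (\<Sum>d<D. F (x + g d))\<^sup>2) \<le> \<epsilon> * real D ^ 2 * real N)"

section \<open>Shift invariance over a period and the van der Corput inequality\<close>

lemma sum_periodic_shift:
  fixes F :: "int \<Rightarrow> real"
  assumes "N > 0" and per: "\<And>x. F (x mod int N) = F x"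
  shows "(\<Sum>x\<in>{0..<int N}. F (x + c)) = (\<Sum>x\<in>{0..<int N}. F x)"
proof (rule sum.reindex_bij_witness[where i = "\<lambda>x. (x - c) mod int N" and j = "\<lambda>x. (x + c) mod int N"])
  show "F ((x + c) mod int N) = F (x + c)" for x by (rule per)
qed (use \<open>N > 0\<close> in \<open>auto simp: mod_simps\<close>)

lemma periodic_bdd_mod_add:
  assumes "periodic_bdd N F"
  shows "F (x mod int N + c) = F (x + c)" "F (x mod int N + c + d) = F (x + c + d)"
    "F (x mod int N - c) = F (x - c)" "F (x mod int N) = F x"
proof -
  have per: "F (y mod int N) = F y" for y using assms unfolding periodic_bdd_def by blast
  show "F (x mod int N + c) = F (x + c)" for c
    using per[of "x mod int N + c"] per[of "x + c"] by (simp add: mod_simps)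
  from this[of "c + d"] show "F (x mod int N + c + d) = F (x + c + d)" by (simp add: add.assoc)
  show "F (x mod int N - c) = F (x - c)"
    using per[of "x mod int N - c"] per[of "x - c"] by (simp add: mod_simps)
qed (use assms in \<open>auto simp: periodic_bdd_def\<close>)

lemma ap_small_mono:
  assumes "ap_small k Q' L \<eta>' N F" "Q \<le> Q'" "\<eta>' \<le> \<eta>"
  shows "ap_small k Q L \<eta> N F"
  unfolding ap_small_def
proof
  fix q assume "q \<in> {1..Q}"
  then have "(\<Sum>x\<in>{0..<int N}. (\<Sum>i<L. F (x + int (q ^ k * i)))\<^sup>2) \<le> \<eta>' * real L ^ 2 * real N"
    using assms(1,2) unfolding ap_small_def by auto
  also have "\<dots> \<le> \<eta> * real L ^ 2 * real N"
    using assms(3) by (intro mult_right_mono) auto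
  finally show "(\<Sum>x\<in>{0..<int N}. (\<Sum>i<L. F (x + int (q ^ k * i)))\<^sup>2) \<le> \<eta> * real L ^ 2 * real N" .
qed

lemma sum_square_le_card:
  fixes f :: "'a \<Rightarrow> real"
  shows "(\<Sum>i\<in>I. f i)\<^sup>2 \<le> real (card I) * (\<Sum>i\<in>I. (f i)\<^sup>2)"
  using Cauchy_Schwarz_ineq_sum[of "\<lambda>_. 1" f I] by simp

lemma sum_shift_diff_le:
  fixes a :: "nat \<Rightarrow> real"
  assumes "\<And>d. \<bar>a d\<bar> \<le> 1"
  shows "\<bar>(\<Sum>d<D. a (d + t)) - (\<Sum>d<D. a d)\<bar> \<le> 2 * real t"
proof (induction t)
  case (Suc t)
  have "(\<Sum>d<D. a (d + Suc t)) = (\<Sum>d<D. a (d + t)) + a (D + t) - a t"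
    by (induction D) auto
  with Suc assms[of "D + t"] assms[of t] show ?case by simp
qed simp

text \<open>The van der Corput trick: replace \<open>a d\<close> by its average over a window of \<open>H\<close> steps of size \<open>m\<close>.\<close>

lemma square_sum_le_windows:
  fixes a :: "nat \<Rightarrow> real"
  assumes a: "\<And>d. \<bar>a d\<bar> \<le> 1" and "H > 0"
  shows "(\<Sum>d<D. a d)\<^sup>2 \<le> 2 * real D / real H ^ 2 * (\<Sum>d<D. (\<Sum>h<H. a (d + m * h))\<^sup>2)
           + 8 * real m ^ 2 * real H ^ 2"
proof -
  define S where "S = (\<Sum>d<D. a d)"
  define X where "X = (\<Sum>d<D. \<Sum>h<H. a (d + m * h))"
  have "\<bar>X - real H * S\<bar> = \<bar>\<Sum>h<H. (\<Sum>d<D. a (d + m * h)) - S\<bar>"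
    unfolding X_def by (subst sum.swap) (simp add: sum_subtractf)
  also have "\<dots> \<le> (\<Sum>h<H. \<bar>(\<Sum>d<D. a (d + m * h)) - S\<bar>)" by (rule sum_abs)
  also have "\<dots> \<le> (\<Sum>h<H. 2 * (real m * real H))"
  proof (rule sum_mono)
    fix h assume "h \<in> {..<H}"
    then have "real m * real h \<le> real m * real H" by (intro mult_left_mono) auto
    then show "\<bar>(\<Sum>d<D. a (d + m * h)) - S\<bar> \<le> 2 * (real m * real H)"
      using sum_shift_diff_le[of a "m * h" D, OF a] unfolding S_def by simp
  qed
  finally have "\<bar>X - real H * S\<bar> \<le> 2 * real m * real H ^ 2"
    by (simp add: power2_eq_square mult_ac)
  then have err: "(real H * S - X)\<^sup>2 \<le> (2 * real m * real H ^ 2)\<^sup>2"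
    by (intro abs_le_square_iff[THEN iffD1]) (simp add: abs_minus_commute)
  have "(real H * S)\<^sup>2 \<le> 2 * X\<^sup>2 + 2 * (real H * S - X)\<^sup>2"
    using sum_squares_ge_zero[of "real H * S - 2 * X" 0] by (simp add: power2_eq_square algebra_simps)
  also have "\<dots> \<le> 2 * (real D * (\<Sum>d<D. (\<Sum>h<H. a (d + m * h))\<^sup>2)) + 2 * (2 * real m * real H ^ 2)\<^sup>2"
    using err sum_square_le_card[of "\<lambda>d. \<Sum>h<H. a (d + m * h)" "{..<D}"] unfolding X_def by simp
  finally have "real H ^ 2 * S\<^sup>2 \<le> 2 * real D * (\<Sum>d<D. (\<Sum>h<H. a (d + m * h))\<^sup>2) + 8 * real m ^ 2 * real H ^ 4"
    by (simp add: power_mult_distrib)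
  then show ?thesis
    using \<open>H > 0\<close> unfolding S_def[symmetric]
    by (simp add: field_simps power4_eq_xxxx power2_eq_square)
qed

text \<open>Two choices of the step \<open>m\<close> matter later: one that turns windows of a
  linear sequence into progressions with \<open>k\<close>-th power difference, and
  \<open>m = 1\<close> for differencing.\<close>

lemma sum_window_bound:
  assumes F: "periodic_bdd N F" and "H > 0"
  shows "(\<Sum>x\<in>{0..<int N}. (\<Sum>d<D. F (x + g d))\<^sup>2)
     \<le> 2 * real D / real H ^ 2 * (\<Sum>d<D. \<Sum>x\<in>{0..<int N}. (\<Sum>h<H. F (x + g (d + m * h)))\<^sup>2)
        + 8 * real m ^ 2 * real H ^ 2 * real N"
proof -
  have "(\<Sum>x\<in>{0..<int N}. (\<Sum>d<D. F (x + g d))\<^sup>2) \<le>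
      (\<Sum>x\<in>{0..<int N}. 2 * real D / real H ^ 2 * (\<Sum>d<D. (\<Sum>h<H. F (x + g (d + m * h)))\<^sup>2)
           + 8 * real m ^ 2 * real H ^ 2)"
    using F \<open>H > 0\<close> unfolding periodic_bdd_def
    by (intro sum_mono square_sum_le_windows) auto
  also have "\<dots> = 2 * real D / real H ^ 2 * (\<Sum>d<D. \<Sum>x\<in>{0..<int N}. (\<Sum>h<H. F (x + g (d + m * h)))\<^sup>2)
        + 8 * real m ^ 2 * real H ^ 2 * real N"
    by (subst sum.swap[of _ "{0..<int N}" "{..<D}"]) (simp add: sum.distrib sum_distrib_left)
  finally show ?thesis .
qed

lemma ex_nat_square_ge:
  fixes c \<epsilon> :: real assumes "\<epsilon> > 0"
  obtains D\<^sub>0 :: nat where "\<And>D. D \<ge> D\<^sub>0 \<Longrightarrow> c \<le> \<epsilon> * real D ^ 2"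
proof -
  obtain n :: nat where n: "real n \<ge> c / \<epsilon>" using real_arch_simple by blast
  show ?thesis
  proof (rule that[of "Suc n"])
    fix D assume D: "D \<ge> Suc n"
    have "c \<le> \<epsilon> * real n" using n assms by (simp add: field_simps)
    also have "\<dots> \<le> \<epsilon> * real D ^ 2"
    proof (intro mult_left_mono)
      have "real n \<le> real D" using D by simp
      also have "\<dots> \<le> real D ^ 2" using D by (intro self_le_power) auto
      finally show "real n \<le> real D ^ 2" .
    qed (use assms in auto)
    finally show "c \<le> \<epsilon> * real D ^ 2" .
  qed
qed

text \<open>Reading a progression backwards amounts to shifting its starting point, which the sum
  over a period absorbs. This handles negative slopes.\<close>

lemma sum_ap_reverse:
  assumes F: "periodic_bdd N F"
  shows "(\<Sum>x\<in>{0..<int N}. (\<Sum>i<L. F (x - b * int i))\<^sup>2) = (\<Sum>x\<in>{0..<int N}. (\<Sum>i<L. F (x + b * int i))\<^sup>2)"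
proof -
  have "(\<Sum>i<L. F (x + b * int i)) = (\<Sum>i<L. F ((x + b * (int L - 1)) - b * int i))" for x
    by (subst sum.nat_diff_reindex[symmetric], rule sum.cong)
       (auto simp: of_nat_diff algebra_simps)
  then have "(\<Sum>x\<in>{0..<int N}. (\<Sum>i<L. F (x + b * int i))\<^sup>2) =
      (\<Sum>x\<in>{0..<int N}. (\<lambda>x. (\<Sum>i<L. F (x - b * int i))\<^sup>2) (x + b * (int L - 1)))" by simp
  also have "\<dots> = (\<Sum>x\<in>{0..<int N}. (\<Sum>i<L. F (x - b * int i))\<^sup>2)"
    using F by (intro sum_periodic_shift) (auto simp: periodic_bdd_mod_add[OF F] periodic_bdd_def)
  finally show ?thesis by simp
qed

section \<open>Linear sequences and the differencing step\<close>

text \<open>With window step |a|^(k-1), consecutive terms of a window differ by |a|^k up to sign. So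
  every window is a translate of a progression that \<open>ap_small\<close> controls.\<close>

lemma controlled_linear:
  assumes "a \<noteq> 0" and "k \<ge> 1"
  shows "controlled k (\<lambda>d. a * int d + c)"
  unfolding controlled_def
proof (intro allI impI)
  fix \<epsilon> :: real assume \<epsilon>: "\<epsilon> > 0"
  define b where "b = nat \<bar>a\<bar>"
  define m where "m = b ^ (k - 1)"
  have b: "b \<ge> 1" "int b = \<bar>a\<bar>" using assms unfolding b_def by auto
  have mb: "int m * \<bar>a\<bar> = int (b ^ k)"
    using assms b unfolding m_def by (cases k) auto
  show "\<exists>Q. \<exists>\<eta>>0. \<forall>L\<ge>1. \<exists>D\<^sub>0. \<forall>D\<ge>D\<^sub>0. \<forall>N F.
     periodic_bdd N F \<longrightarrow> ap_small k Q L \<eta> N F \<longrightarrow>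
     (\<Sum>x\<in>{0..<int N}. (\<Sum>d<D. F (x + (a * int d + c)))\<^sup>2) \<le> \<epsilon> * real D ^ 2 * real N"
  \<comment> \<open>The only common difference used is \<open>b ^ k\<close>, so
    \<open>Q = b\<close>. The windows contribute twice \<epsilon>/4, and the boundary error takes
    the other \<epsilon>/2 once \<open>D\<close> is large.\<close>
  proof (rule exI[of _ b], rule exI[of _ "\<epsilon> / 4"], intro conjI allI impI)
    fix L :: nat assume "L \<ge> 1"
    obtain D\<^sub>0 where D\<^sub>0: "\<And>D. D \<ge> D\<^sub>0 \<Longrightarrow> 8 * real m ^ 2 * real L ^ 2 \<le> \<epsilon> / 2 * real D ^ 2"
      by (rule ex_nat_square_ge[of "\<epsilon> / 2" "8 * real m ^ 2 * real L ^ 2"]) (use \<epsilon> in auto)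
    show "\<exists>D\<^sub>0. \<forall>D\<ge>D\<^sub>0. \<forall>N F. periodic_bdd N F \<longrightarrow> ap_small k b L (\<epsilon> / 4) N F \<longrightarrow>
       (\<Sum>x\<in>{0..<int N}. (\<Sum>d<D. F (x + (a * int d + c)))\<^sup>2) \<le> \<epsilon> * real D ^ 2 * real N"
    proof (intro exI[of _ D\<^sub>0] allI impI)
      fix D N F assume D: "D \<ge> D\<^sub>0" and F: "periodic_bdd N F" and ap: "ap_small k b L (\<epsilon> / 4) N F"
      have inner: "(\<Sum>x\<in>{0..<int N}. (\<Sum>i<L. F (x + (a * int (d + m * i) + c)))\<^sup>2)
          \<le> \<epsilon> / 4 * real L ^ 2 * real N" for d
      proof -
        have "(\<Sum>x\<in>{0..<int N}. (\<Sum>i<L. F (x + (a * int (d + m * i) + c)))\<^sup>2) =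
            (\<Sum>x\<in>{0..<int N}. (\<lambda>x. (\<Sum>i<L. F (x + a * int m * int i))\<^sup>2) (x + (a * int d + c)))"
          by (simp add: algebra_simps)
        also have "\<dots> = (\<Sum>x\<in>{0..<int N}. (\<Sum>i<L. F (x + a * int m * int i))\<^sup>2)"
          using F by (intro sum_periodic_shift) (auto simp: periodic_bdd_mod_add[OF F] periodic_bdd_def)
        also have "\<dots> = (\<Sum>x\<in>{0..<int N}. (\<Sum>i<L. F (x + int (b ^ k * i)))\<^sup>2)"
        proof (cases "a > 0")
          case True
          then have "a * int m = int (b ^ k)" using mb by (simp add: mult.commute)
          then show ?thesis by simp
        next
          case False
          then have "a * int m = - int (b ^ k)" using mb by (simp add: mult.commute)
          then show ?thesis using sum_ap_reverse[OF F, of "int (b ^ k)" L] by simp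
        qed
        also have "\<dots> \<le> \<epsilon> / 4 * real L ^ 2 * real N"
          by (rule ap[unfolded ap_small_def, rule_format]) (use b(1) in simp)
        finally show ?thesis .
      qed
      have "(\<Sum>x\<in>{0..<int N}. (\<Sum>d<D. F (x + (a * int d + c)))\<^sup>2) \<le>
        2 * real D / real L ^ 2 * (\<Sum>d<D. \<Sum>x\<in>{0..<int N}. (\<Sum>i<L. F (x + (a * int (d + m * i) + c)))\<^sup>2)
        + 8 * real m ^ 2 * real L ^ 2 * real N"
        using \<open>L \<ge> 1\<close> by (intro sum_window_bound[OF F]) auto
      also have "\<dots> \<le> 2 * real D / real L ^ 2 * (\<Sum>d<D. \<epsilon> / 4 * real L ^ 2 * real N)
          + \<epsilon> / 2 * real D ^ 2 * real N"
        using D\<^sub>0[OF D] inner by (intro add_mono mult_left_mono mult_right_mono sum_mono) auto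
      also have "\<dots> = \<epsilon> * real D ^ 2 * real N"
        using \<open>L \<ge> 1\<close> by (simp add: field_simps power2_eq_square)
      finally show "(\<Sum>x\<in>{0..<int N}. (\<Sum>d<D. F (x + (a * int d + c)))\<^sup>2) \<le> \<epsilon> * real D ^ 2 * real N" .
    qed
  qed (use \<epsilon> in auto)
qed

text \<open>Differencing produces one sequence for each pair of window positions, so the parameters
  must be uniform over a finite family: take the largest \<open>Q\<close>, the smallest \<eta> and,
  for each \<open>L\<close>, the largest threshold for \<open>D\<close>.\<close>

lemma controlled_finite:
  assumes "finite G" "\<And>g. g \<in> G \<Longrightarrow> controlled k g" "\<epsilon> > 0"
  shows "\<exists>Q. \<exists>\<eta>>0. \<forall>L\<ge>1. \<exists>D\<^sub>0. \<forall>D\<ge>D\<^sub>0. \<forall>N F. \<forall>g\<in>G.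
     periodic_bdd N F \<longrightarrow> ap_small k Q L \<eta> N F \<longrightarrow>
     (\<Sum>x\<in>{0..<int N}. (\<Sum>d<D. F (x + g d))\<^sup>2) \<le> \<epsilon> * real D ^ 2 * real N"
  using assms(1,2)
proof (induction G rule: finite_induct)
  case empty
  then show ?case by (auto intro: exI[of _ 1])
next
  case (insert g G)
  have "\<exists>Q. \<exists>\<eta>>0. \<forall>L\<ge>1. \<exists>D\<^sub>0. \<forall>D\<ge>D\<^sub>0. \<forall>N F. \<forall>g\<in>G.
     periodic_bdd N F \<longrightarrow> ap_small k Q L \<eta> N F \<longrightarrow>
     (\<Sum>x\<in>{0..<int N}. (\<Sum>d<D. F (x + g d))\<^sup>2) \<le> \<epsilon> * real D ^ 2 * real N"
    using insert.prems by (intro insert.IH) simp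
  then obtain Q \<eta> where "\<eta> > 0" and 1: "\<forall>L\<ge>1. \<exists>D\<^sub>0. \<forall>D\<ge>D\<^sub>0. \<forall>N F. \<forall>g\<in>G.
     periodic_bdd N F \<longrightarrow> ap_small k Q L \<eta> N F \<longrightarrow>
     (\<Sum>x\<in>{0..<int N}. (\<Sum>d<D. F (x + g d))\<^sup>2) \<le> \<epsilon> * real D ^ 2 * real N"
    by blast
  from insert.prems[of g] \<open>\<epsilon> > 0\<close> obtain Q' \<eta>' where "\<eta>' > 0" and 2: "\<forall>L\<ge>1. \<exists>D\<^sub>0. \<forall>D\<ge>D\<^sub>0. \<forall>N F.
     periodic_bdd N F \<longrightarrow> ap_small k Q' L \<eta>' N F \<longrightarrow>
     (\<Sum>x\<in>{0..<int N}. (\<Sum>d<D. F (x + g d))\<^sup>2) \<le> \<epsilon> * real D ^ 2 * real N"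
    unfolding controlled_def by blast
  show ?case
  proof (rule exI[of _ "max Q Q'"], rule exI[of _ "min \<eta> \<eta>'"], intro conjI allI impI)
    fix L :: nat assume L: "L \<ge> 1"
    from 1[rule_format, OF L] obtain D1 where D1: "\<forall>D\<ge>D1. \<forall>N F. \<forall>g\<in>G.
     periodic_bdd N F \<longrightarrow> ap_small k Q L \<eta> N F \<longrightarrow>
     (\<Sum>x\<in>{0..<int N}. (\<Sum>d<D. F (x + g d))\<^sup>2) \<le> \<epsilon> * real D ^ 2 * real N" by (rule exE)
    from 2[rule_format, OF L] obtain D2 where D2: "\<forall>D\<ge>D2. \<forall>N F.
     periodic_bdd N F \<longrightarrow> ap_small k Q' L \<eta>' N F \<longrightarrow>
     (\<Sum>x\<in>{0..<int N}. (\<Sum>d<D. F (x + g d))\<^sup>2) \<le> \<epsilon> * real D ^ 2 * real N" by (rule exE)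
    show "\<exists>D\<^sub>0. \<forall>D\<ge>D\<^sub>0. \<forall>N F. \<forall>g\<in>insert g G.
     periodic_bdd N F \<longrightarrow> ap_small k (max Q Q') L (min \<eta> \<eta>') N F \<longrightarrow>
     (\<Sum>x\<in>{0..<int N}. (\<Sum>d<D. F (x + g d))\<^sup>2) \<le> \<epsilon> * real D ^ 2 * real N"
    proof (intro exI[of _ "max D1 D2"] allI impI ballI)
      fix D N F g' assume D: "D \<ge> max D1 D2" and g': "g' \<in> insert g G" and F: "periodic_bdd N F"
        and ap: "ap_small k (max Q Q') L (min \<eta> \<eta>') N F"
      have "ap_small k Q L \<eta> N F" "ap_small k Q' L \<eta>' N F"
        using ap by (auto intro: ap_small_mono)
      then show "(\<Sum>x\<in>{0..<int N}. (\<Sum>d<D. F (x + g' d))\<^sup>2) \<le> \<epsilon> * real D ^ 2 * real N"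
        using D1 D2 D F g' by auto
    qed
  qed (use \<open>\<eta> > 0\<close> \<open>\<eta>' > 0\<close> in auto)
qed

text \<open>Translating by \<open>g' d\<close> turns the correlation into \<open>F\<close> paired
  with its sum along \<open>g - g'\<close>; Cauchy-Schwarz in \<open>x\<close> then uses |F| <= 1
  and the mean square of that sum.\<close>

lemma correlation_le:
  assumes F: "periodic_bdd N F" and "\<epsilon> \<ge> 0"
    and small: "(\<Sum>x\<in>{0..<int N}. (\<Sum>d<D. F (x + (g d - g' d)))\<^sup>2) \<le> \<epsilon> ^ 2 * real D ^ 2 * real N"
  shows "(\<Sum>x\<in>{0..<int N}. \<Sum>d<D. F (x + g d) * F (x + g' d)) \<le> \<epsilon> * real D * real N"
proof -
  have F1: "(F x)\<^sup>2 \<le> 1" for x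
    using F unfolding periodic_bdd_def by (simp add: abs_square_le_1)
  have N: "N > 0" using F unfolding periodic_bdd_def by blast
  have shift: "(\<Sum>x\<in>{0..<int N}. F (x + g d) * F (x + g' d)) = (\<Sum>x\<in>{0..<int N}. F x * F (x + (g d - g' d)))" for d
    using sum_periodic_shift[OF N, of "\<lambda>x. F x * F (x + (g d - g' d))" "g' d"]
    by (simp add: periodic_bdd_mod_add[OF F] mult.commute)
  have "(\<Sum>x\<in>{0..<int N}. \<Sum>d<D. F (x + g d) * F (x + g' d)) = (\<Sum>d<D. \<Sum>x\<in>{0..<int N}. F (x + g d) * F (x + g' d))"
    by (rule sum.swap)
  also have "\<dots> = (\<Sum>x\<in>{0..<int N}. F x * (\<Sum>d<D. F (x + (g d - g' d))))"
    unfolding shift sum_distrib_left by (rule sum.swap)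
  finally have "(\<Sum>x\<in>{0..<int N}. \<Sum>d<D. F (x + g d) * F (x + g' d)) = (\<Sum>x\<in>{0..<int N}. F x * (\<Sum>d<D. F (x + (g d - g' d))))" .
  moreover have "(\<Sum>x\<in>{0..<int N}. F x * (\<Sum>d<D. F (x + (g d - g' d)))) \<le> \<epsilon> * real D * real N"
  proof (rule power2_le_imp_le)
    have "(\<Sum>x\<in>{0..<int N}. F x * (\<Sum>d<D. F (x + (g d - g' d))))\<^sup>2 \<le>
       (\<Sum>x\<in>{0..<int N}. (F x)\<^sup>2) * (\<Sum>x\<in>{0..<int N}. (\<Sum>d<D. F (x + (g d - g' d)))\<^sup>2)"
      by (rule Cauchy_Schwarz_ineq_sum)
    also have "\<dots> \<le> real N * (\<epsilon> ^ 2 * real D ^ 2 * real N)"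
    proof (rule mult_mono)
      show "(\<Sum>x\<in>{0..<int N}. (F x)\<^sup>2) \<le> real N"
        using sum_bounded_above[of "{0..<int N}" "\<lambda>x. (F x)\<^sup>2" 1] F1 by simp
    qed (use small in \<open>auto intro: sum_nonneg\<close>)
    also have "\<dots> = (\<epsilon> * real D * real N)\<^sup>2" by (simp add: power2_eq_square)
    finally show "(\<Sum>x\<in>{0..<int N}. F x * (\<Sum>d<D. F (x + (g d - g' d))))\<^sup>2 \<le> (\<epsilon> * real D * real N)\<^sup>2" .
  qed (use \<open>\<epsilon> \<ge> 0\<close> in simp)
  ultimately show ?thesis by linarith
qed

text \<open>Expanding the squared windows gives correlations between the shifts \<open>h\<close> and
  \<open>h'\<close>. The diagonal is a 1/H fraction of all pairs, and off the diagonal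
  \<open>correlation_le\<close> reduces to the controlled differences.\<close>

lemma controlled_step:
  assumes ctl: "\<And>h h'. h \<noteq> h' \<Longrightarrow> controlled k (\<lambda>d. g (d + h) - g (d + h'))"
  shows "controlled k g"
  unfolding controlled_def
proof (intro allI impI)
  fix \<epsilon> :: real assume \<epsilon>: "\<epsilon> > 0"
  \<comment> \<open>The diagonal contributes 2/H, which this choice makes at most
    \<epsilon>/4.\<close>
  obtain H :: nat where H8: "real H > 8 / \<epsilon>" using reals_Archimedean2 by blast
  then have "H > 0" using \<epsilon> by (auto intro!: Nat.gr0I simp: zero_less_divide_iff dest: less_trans)
  with H8 \<epsilon> have H: "H > 0" "2 / real H \<le> \<epsilon> / 4"
    by (auto simp: field_simps)
  define G where "G = (\<lambda>(h, h'). (\<lambda>d. g (d + h) - g (d + h'))) ` {(h, h'). h < H \<and> h' < H \<and> h \<noteq> h'}"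
  have "finite {(h, h'). h < H \<and> h' < H \<and> h \<noteq> h'}"
    by (rule finite_subset[of _ "{..<H} \<times> {..<H}"]) auto
  then have "finite G" unfolding G_def by simp
  moreover have "controlled k f" if "f \<in> G" for f using that ctl unfolding G_def by auto
  \<comment> \<open>\<open>correlation_le\<close> takes a square root, so the off-diagonal pairs
    contribute at most twice \<epsilon>/8.\<close>
  moreover have "(\<epsilon> / 8)\<^sup>2 > 0" using \<epsilon> by simp
  ultimately have "\<exists>Q. \<exists>\<eta>>0. \<forall>L\<ge>1. \<exists>D\<^sub>0. \<forall>D\<ge>D\<^sub>0. \<forall>N F. \<forall>f\<in>G.
     periodic_bdd N F \<longrightarrow> ap_small k Q L \<eta> N F \<longrightarrow>
     (\<Sum>x\<in>{0..<int N}. (\<Sum>d<D. F (x + f d))\<^sup>2) \<le> (\<epsilon> / 8)\<^sup>2 * real D ^ 2 * real N"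
    by (rule controlled_finite)
  then obtain Q \<eta> where "\<eta> > 0" and 1: "\<forall>L\<ge>1. \<exists>D\<^sub>0. \<forall>D\<ge>D\<^sub>0. \<forall>N F. \<forall>f\<in>G.
     periodic_bdd N F \<longrightarrow> ap_small k Q L \<eta> N F \<longrightarrow>
     (\<Sum>x\<in>{0..<int N}. (\<Sum>d<D. F (x + f d))\<^sup>2) \<le> (\<epsilon> / 8)\<^sup>2 * real D ^ 2 * real N"
    by blast
  show "\<exists>Q. \<exists>\<eta>>0. \<forall>L\<ge>1. \<exists>D\<^sub>0. \<forall>D\<ge>D\<^sub>0. \<forall>N F.
     periodic_bdd N F \<longrightarrow> ap_small k Q L \<eta> N F \<longrightarrow>
     (\<Sum>x\<in>{0..<int N}. (\<Sum>d<D. F (x + g d))\<^sup>2) \<le> \<epsilon> * real D ^ 2 * real N"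
  proof (rule exI[of _ Q], rule exI[of _ \<eta>], intro conjI allI impI)
    fix L :: nat assume "L \<ge> 1"
    from 1[rule_format, OF this] obtain D1 where D1: "\<forall>D\<ge>D1. \<forall>N F. \<forall>f\<in>G.
     periodic_bdd N F \<longrightarrow> ap_small k Q L \<eta> N F \<longrightarrow>
     (\<Sum>x\<in>{0..<int N}. (\<Sum>d<D. F (x + f d))\<^sup>2) \<le> (\<epsilon> / 8)\<^sup>2 * real D ^ 2 * real N" by (rule exE)
    obtain D2 where D2: "\<And>D. D \<ge> D2 \<Longrightarrow> 8 * real H ^ 2 \<le> \<epsilon> / 4 * real D ^ 2"
      by (rule ex_nat_square_ge[of "\<epsilon> / 4" "8 * real H ^ 2"]) (use \<epsilon> in auto)
    show "\<exists>D\<^sub>0. \<forall>D\<ge>D\<^sub>0. \<forall>N F. periodic_bdd N F \<longrightarrow> ap_small k Q L \<eta> N F \<longrightarrow>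
       (\<Sum>x\<in>{0..<int N}. (\<Sum>d<D. F (x + g d))\<^sup>2) \<le> \<epsilon> * real D ^ 2 * real N"
    proof (intro exI[of _ "max D1 D2"] allI impI)
      fix D N F assume D: "D \<ge> max D1 D2" and F: "periodic_bdd N F" and ap: "ap_small k Q L \<eta> N F"
      define c where "c h h' = (\<Sum>x\<in>{0..<int N}. \<Sum>d<D. F (x + g (d + h)) * F (x + g (d + h')))" for h h'
      have c: "c h h' \<le> (if h = h' then real D * real N else 0) + \<epsilon> / 8 * real D * real N"
        if "h < H" "h' < H" for h h'
      proof (cases "h = h'")
        case True
        have "(F y)\<^sup>2 \<le> 1" for y
          using F unfolding periodic_bdd_def by (simp add: abs_square_le_1)
        then have "c h h' \<le> (\<Sum>x\<in>{0..<int N}. \<Sum>d<D. 1)"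
          unfolding c_def True power2_eq_square[symmetric] by (intro sum_mono)
        also have "\<dots> = real D * real N" by simp
        finally show ?thesis using True \<epsilon> by (simp add: add_increasing2)
      next
        case False
        then have "(\<lambda>d. g (d + h) - g (d + h')) \<in> G" using that unfolding G_def by auto
        then have "(\<Sum>x\<in>{0..<int N}. (\<Sum>d<D. F (x + (g (d + h) - g (d + h'))))\<^sup>2) \<le> (\<epsilon> / 8)\<^sup>2 * real D ^ 2 * real N"
          using D1[rule_format, of D "\<lambda>d. g (d + h) - g (d + h')" N F] D F ap by simp
        then have "c h h' \<le> \<epsilon> / 8 * real D * real N"
          unfolding c_def using \<epsilon> by (intro correlation_le[OF F]) auto
        with False show ?thesis by simp
      qed
      have "(\<Sum>d<D. \<Sum>x\<in>{0..<int N}. (\<Sum>h<H. F (x + g (d + 1 * h)))\<^sup>2) = (\<Sum>h<H. \<Sum>h'<H. c h h')"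
      proof -
        have "(\<Sum>h<H. \<Sum>h'<H. c h h') = (\<Sum>x\<in>{0..<int N}. \<Sum>d<D. \<Sum>h<H. \<Sum>h'<H. F (x + g (d + h)) * F (x + g (d + h')))"
          unfolding c_def
          by (simp only: sum.swap[of _ "{0..<int N}" "{..<H}"] sum.swap[of _ "{..<D}" "{..<H}"])
        also have "\<dots> = (\<Sum>x\<in>{0..<int N}. \<Sum>d<D. (\<Sum>h<H. F (x + g (d + 1 * h)))\<^sup>2)"
          by (simp add: power2_eq_square sum_product)
        also have "\<dots> = (\<Sum>d<D. \<Sum>x\<in>{0..<int N}. (\<Sum>h<H. F (x + g (d + 1 * h)))\<^sup>2)"
          by (rule sum.swap)
        finally show ?thesis by simp
      qed
      also have "\<dots> \<le> (\<Sum>h<H. \<Sum>h'<H. (if h = h' then real D * real N else 0) + \<epsilon> / 8 * real D * real N)"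
        using c by (intro sum_mono) auto
      also have "\<dots> = real H * real D * real N + real H ^ 2 * (\<epsilon> / 8) * real D * real N"
        by (simp add: sum.distrib power2_eq_square algebra_simps)
      finally have T: "(\<Sum>d<D. \<Sum>x\<in>{0..<int N}. (\<Sum>h<H. F (x + g (d + 1 * h)))\<^sup>2)
          \<le> real H * real D * real N + real H ^ 2 * (\<epsilon> / 8) * real D * real N" .
      have "(\<Sum>x\<in>{0..<int N}. (\<Sum>d<D. F (x + g d))\<^sup>2) \<le>
        2 * real D / real H ^ 2 * (\<Sum>d<D. \<Sum>x\<in>{0..<int N}. (\<Sum>h<H. F (x + g (d + 1 * h)))\<^sup>2)
        + 8 * real 1 ^ 2 * real H ^ 2 * real N"
        using H by (intro sum_window_bound[OF F]) auto
      also have "\<dots> \<le> 2 * real D / real H ^ 2 * (real H * real D * real N + real H ^ 2 * (\<epsilon> / 8) * real D * real N)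
          + \<epsilon> / 4 * real D ^ 2 * real N"
        using D2[of D] D T by (intro add_mono mult_left_mono mult_right_mono) auto
      also have "\<dots> = (2 / real H + \<epsilon> / 4 + \<epsilon> / 4) * (real D ^ 2 * real N)"
        using H(1) by (simp add: field_simps power2_eq_square)
      also have "\<dots> \<le> \<epsilon> * (real D ^ 2 * real N)"
        using H \<epsilon> by (intro mult_right_mono) auto
      finally show "(\<Sum>x\<in>{0..<int N}. (\<Sum>d<D. F (x + g d))\<^sup>2) \<le> \<epsilon> * real D ^ 2 * real N"
        by (simp add: mult.assoc)
    qed
  qed (use \<open>\<eta> > 0\<close> in auto)
qed

section \<open>Degree lowering for integer polynomials\<close>

text \<open>If the difference under the shift \<open>c\<close> were constant, \<open>p\<close> would
  be affine on the natural multiples of \<open>c\<close>, and a polynomial that agrees with an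
  affine one infinitely often has degree at most 1.\<close>

lemma poly_shift_diff_nonconstant:
  fixes p :: "int poly"
  assumes deg: "degree p \<ge> 2" and c: "c \<noteq> 0"
    and const: "\<And>x. poly p (x + c) - poly p x = b"
  shows False
proof -
  \<comment> \<open>Substituting c X, instead of dividing by \<open>c\<close>, keeps the comparison
    with an affine polynomial over the integers.\<close>
  define l where "l = pcompose p [:0, c:] - [:poly p 0, b:]"
  have val: "poly p (c * int n) = poly p 0 + b * int n" for n
  proof (induction n)
    case (Suc n)
    then show ?case using const[of "c * int n"] by (simp add: algebra_simps)
  qed simp
  have "range int \<subseteq> {x. poly l x = 0}"
    unfolding l_def by (auto simp: poly_pcompose val mult.commute)
  then have "infinite {x. poly l x = 0}"
    using finite_subset infinite_UNIV_nat finite_imageD inj_of_nat by metis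
  then have "l = 0" using poly_roots_finite by blast
  then have "degree (pcompose p [:0, c:]) \<le> 1" unfolding l_def by simp
  then show False using deg c by (simp add: degree_pcompose)
qed

text \<open>Translating the argument preserves degree and leading coefficient, so the top terms
  cancel.\<close>

lemma degree_shift_diff_less:
  fixes p :: "int poly"
  assumes "degree p > 0"
  shows "degree (pcompose p [:h, 1:] - pcompose p [:h', 1:]) < degree p"
proof -
  have "degree (pcompose p [:h, 1:]) = degree p" "coeff (pcompose p [:h, 1:]) (degree p) = lead_coeff p" for h
    using lead_coeff_comp[of "[:h, 1:]" p] by (simp_all add: degree_pcompose)
  then have "degree (pcompose p [:h, 1:] - pcompose p [:h', 1:]) \<le> degree p"
     "coeff (pcompose p [:h, 1:] - pcompose p [:h', 1:]) (degree p) = 0"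
    by (simp_all add: degree_diff_le)
  then show ?thesis using assms
    by (metis degree_0 eq_zero_or_degree_less)
qed

text \<open>Induction on the degree: one differencing lowers it, but not to 0 when it is at least 2,
  so the recursion stops at the linear case.\<close>

lemma controlled_poly:
  fixes p :: "int poly"
  assumes "k \<ge> 1" "degree p \<ge> 1"
  shows "controlled k (\<lambda>d. poly p (int d))"
  using assms(2)
proof (induction "degree p" arbitrary: p rule: less_induct)
  case less
  show ?case
  proof (cases "degree p = 1")
    case True
    then obtain c a where "p = [:c, a:]" "a \<noteq> 0" using degree1_coeffs by blast
    then show ?thesis using controlled_linear[of a k c] assms(1) by (simp add: algebra_simps)
  next
    case False
    then have deg: "degree p \<ge> 2" using less.prems by simp
    show ?thesis
    proof (rule controlled_step)
      fix h h' :: nat assume "h \<noteq> h'"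
      define q where "q = pcompose p [:int h, 1:] - pcompose p [:int h', 1:]"
      have q: "poly q x = poly p (x + int h) - poly p (x + int h')" for x
        unfolding q_def by (simp add: poly_pcompose add.commute)
      have "degree q \<noteq> 0"
      proof
        assume "degree q = 0"
        then obtain b where b: "q = [:b:]" using degree0_coeffs by blast
        have "poly p (x + (int h - int h')) - poly p x = b" for x
          using q[of "x - int h'"] unfolding b by (simp add: algebra_simps)
        with deg \<open>h \<noteq> h'\<close> show False
          using poly_shift_diff_nonconstant[of p "int h - int h'" b] by simp
      qed
      moreover have "degree q < degree p"
        unfolding q_def using deg by (intro degree_shift_diff_less) simp
      ultimately have "controlled k (\<lambda>d. poly q (int d))" by (intro less.hyps) auto
      then show "controlled k (\<lambda>d. poly p (int (d + h)) - poly p (int (d + h')))"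
        by (simp add: q)
    qed
  qed
qed

text \<open>The sums start at \<open>d = 0\<close>, while only positive bases count as differences;
  hence \<open>d + 1\<close>.\<close>

lemma controlled_power:
  assumes "k \<ge> 1"
  shows "controlled k (\<lambda>d. (int d + 1) ^ k)"
  using controlled_poly[of k "[:1, 1:] ^ k"] assms
  by (simp add: degree_linear_power poly_power add.commute)

section \<open>Sets of positive density contain power differences\<close>

definition power_free :: "nat \<Rightarrow> int set \<Rightarrow> bool" where
  "power_free k A \<longleftrightarrow> (\<forall>a d. d > 0 \<longrightarrow> a \<in> A \<longrightarrow> a + d ^ k \<notin> A)"

lemma power_free_empty [simp]: "power_free k {}"
  by (simp add: power_free_def)

lemma power_free_subset: "power_free k A \<Longrightarrow> B \<subseteq> A \<Longrightarrow> power_free k B"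
  unfolding power_free_def by blast

text \<open>\<alpha> is the infimum over lengths of the maximal density: it bounds every length from
  below and, being an infimum, is nearly attained at some \<open>L\<close>. The hypothesis
  \<open>large\<close> gives \<epsilon> <= \<alpha>, hence \<alpha> > 0.\<close>

lemma extremal_density:
  assumes "\<epsilon> > 0"
    and large: "\<And>M. M > 0 \<Longrightarrow> \<exists>A \<subseteq> {0..<int M}. power_free k A \<and> \<epsilon> * real M \<le> real (card A)"
  obtains \<alpha> where "\<alpha> > 0"
    "\<And>M. M > 0 \<Longrightarrow> \<exists>A \<subseteq> {0..<int M}. power_free k A \<and> \<alpha> * real M \<le> real (card A)"
    "\<And>\<eta>. \<eta> > 0 \<Longrightarrow> \<exists>L>0. \<forall>A \<subseteq> {0..<int L}. power_free k A \<longrightarrow> real (card A) \<le> (\<alpha> + \<eta>) * real L"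
proof -
  define S where "S M = card ` {A. A \<subseteq> {0..<int M} \<and> power_free k A}" for M
  define f where "f M = real (Max (S M)) / real M" for M
  define \<alpha> where "\<alpha> = (INF M\<in>{1..}. f M)"
  have fin: "finite (S M)" for M unfolding S_def by simp
  have ne: "S M \<noteq> {}" for M unfolding S_def by (auto intro!: exI[of _ "{}"])
  have le: "card A \<le> Max (S M)" if "A \<subseteq> {0..<int M}" "power_free k A" for A M
    using that fin by (intro Max_ge) (auto simp: S_def)
  have f\<epsilon>: "\<epsilon> \<le> f M" if M: "M \<ge> 1" for M
  proof -
    obtain A where "A \<subseteq> {0..<int M}" "power_free k A" "\<epsilon> * real M \<le> real (card A)"
      using large[of M] M by auto
    then have "\<epsilon> * real M \<le> real (Max (S M))" using le[of A M] by linarith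
    then show ?thesis unfolding f_def using M by (simp add: field_simps)
  qed
  have bdd: "bdd_below (f ` {1..})"
    using f\<epsilon> by (intro bdd_belowI2[of _ \<epsilon>]) auto
  show ?thesis
  proof
    have "\<epsilon> \<le> \<alpha>" unfolding \<alpha>_def using f\<epsilon> by (intro cINF_greatest) auto
    then show "\<alpha> > 0" using \<open>\<epsilon> > 0\<close> by simp
  next
    fix M :: nat assume "M > 0"
    then have "\<alpha> \<le> f M" unfolding \<alpha>_def using bdd by (intro cINF_lower) auto
    then have "\<alpha> * real M \<le> real (Max (S M))" unfolding f_def using \<open>M > 0\<close> by (simp add: field_simps)
    moreover have "Max (S M) \<in> S M" using fin ne by (rule Max_in)
    then obtain A where "A \<subseteq> {0..<int M}" "power_free k A" "Max (S M) = card A"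
      unfolding S_def by blast
    ultimately show "\<exists>A \<subseteq> {0..<int M}. power_free k A \<and> \<alpha> * real M \<le> real (card A)"
      by (intro exI[of _ A]) simp
  next
    fix \<eta> :: real assume "\<eta> > 0"
    then have "Inf (f ` {1..}) < \<alpha> + \<eta>" unfolding \<alpha>_def by simp
    then obtain L where L: "L \<ge> 1" "f L < \<alpha> + \<eta>"
      using cInf_lessD[of "f ` {1..}" "\<alpha> + \<eta>"] by auto
    then have "real (Max (S L)) \<le> (\<alpha> + \<eta>) * real L" unfolding f_def by (simp add: field_simps)
    then have "\<forall>A \<subseteq> {0..<int L}. power_free k A \<longrightarrow> real (card A) \<le> (\<alpha> + \<eta>) * real L"
      using le[of _ L] by (auto intro: order_trans[OF of_nat_mono])
    then show "\<exists>L>0. \<forall>A \<subseteq> {0..<int L}. power_free k A \<longrightarrow> real (card A) \<le> (\<alpha> + \<eta>) * real L"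
      using L(1) by (intro exI[of _ L]) simp
  qed
qed

lemma card_int_tail: "card {int n - int m..<int n} = m"
  by simp

lemma sum_of_bool_mod:
  assumes "A \<subseteq> {0..<int n}"
  shows "(\<Sum>x\<in>{0..<int n}. of_bool (x mod int n \<in> A)) = real (card A)"
proof -
  have "(\<Sum>x\<in>{0..<int n}. of_bool (x mod int n \<in> A)) = (\<Sum>x\<in>{0..<int n}. of_bool (x \<in> A) :: real)"
    by (rule sum.cong) auto
  also have "\<dots> = real (card ({0..<int n} \<inter> A))" by simp
  also have "{0..<int n} \<inter> A = A" using assms by blast
  finally show ?thesis .
qed

text \<open>Indices that differ by \<open>d ^ k\<close> give elements of \<open>A\<close> that
  differ by (q d)^k, so the index set is again power free. This is what singles out
  \<open>k\<close>-th powers as common differences.\<close>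

lemma card_ap_le:
  assumes A: "power_free k A" and q: "q \<ge> 1"
    and bnd: "\<forall>B \<subseteq> {0..<int L}. power_free k B \<longrightarrow> real (card B) \<le> \<beta>"
  shows "(\<Sum>i<L. of_bool (x + int (q ^ k * i) \<in> A)) \<le> \<beta>"
proof -
  define I where "I = {i. i < L \<and> x + int (q ^ k * i) \<in> A}"
  have "power_free k (int ` I)"
    unfolding power_free_def
  proof (intro allI impI notI)
    fix a d :: int assume d: "d > 0" and "a \<in> int ` I" "a + d ^ k \<in> int ` I"
    then obtain i j where ij: "a = int i" "a + d ^ k = int j" "i \<in> I" "j \<in> I" by blast
    then have "x + int (q ^ k) * int i \<in> A" "x + int (q ^ k) * int j \<in> A"
      unfolding I_def by simp_all
    moreover have "x + int (q ^ k) * int j = (x + int (q ^ k) * int i) + (int q * d) ^ k"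
      unfolding ij(2)[symmetric] ij(1)[symmetric] by (simp add: distrib_left power_mult_distrib)
    moreover have "int q * d > 0" using d q by simp
    ultimately show False using A unfolding power_free_def by metis
  qed
  moreover have "int ` I \<subseteq> {0..<int L}" unfolding I_def by auto
  ultimately have "real (card (int ` I)) \<le> \<beta>" using bnd by blast
  moreover have "card (int ` I) = card I" by (simp add: card_image)
  moreover have "(\<Sum>i<L. of_bool (x + int (q ^ k * i) \<in> A)) = real (card ({..<L} \<inter> {i. x + int (q ^ k * i) \<in> A}))"
    by simp
  moreover have "{..<L} \<inter> {i. x + int (q ^ k * i) \<in> A} = I" unfolding I_def by blast
  ultimately show ?thesis by simp
qed

text \<open>The count \<open>u\<close> on a progression has mean at least \<alpha> L and, except
  near the right end, is at most (\<alpha> + \<eta>/2) L. An upper bound this close to the mean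
  forces a small mean square deviation.\<close>

lemma extremal_ap_small:
  fixes \<alpha> \<eta> :: real
  assumes A: "A \<subseteq> {0..<int n}" "power_free k A" "\<alpha> * real n \<le> real (card A)"
    and "\<alpha> > 0" "\<eta> > 0" "n > 0"
    and bnd: "\<forall>B \<subseteq> {0..<int L}. power_free k B \<longrightarrow> real (card B) \<le> (\<alpha> + \<eta> / 2) * real L"
    and edge: "real (Q ^ k * L) \<le> \<eta> / 2 * real n"
  shows "ap_small k Q L \<eta> n (\<lambda>x. of_bool (x mod int n \<in> A) - \<alpha>)"
  unfolding ap_small_def
proof
  fix q assume q: "q \<in> {1..Q}"
  define u :: "int \<Rightarrow> real" where "u x = (\<Sum>i<L. of_bool ((x + int (q ^ k * i)) mod int n \<in> A))" for x
  have u0: "u x \<ge> 0" for x unfolding u_def by (intro sum_nonneg) auto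
  have uL: "u x \<le> real L" for x
    unfolding u_def using sum_bounded_above[of "{..<L}" "\<lambda>i. of_bool ((x + int (q ^ k * i)) mod int n \<in> A)" "1::real"]
    by simp
  \<comment> \<open>Progressions starting among the last \<open>Q ^ k * L\<close> points may wrap
    around modulo \<open>n\<close> and get the trivial bound L^2. Elsewhere one factor
    \<open>u x\<close> is bounded and the other kept, so that summation can use the exact total of
    \<open>u\<close>.\<close>
  have u2: "(u x)\<^sup>2 \<le> (\<alpha> + \<eta> / 2) * real L * u x + (if x \<in> {int n - int (Q ^ k * L)..<int n} then real L ^ 2 else 0)"
    if x: "x \<in> {0..<int n}" for x
  proof (cases "x \<in> {int n - int (Q ^ k * L)..<int n}")
    case True
    have "(u x)\<^sup>2 \<le> real L ^ 2" using u0 uL by (intro power_mono)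
    moreover have "(\<alpha> + \<eta> / 2) * real L * u x \<ge> 0" using u0 assms by simp
    ultimately show ?thesis using True by simp
  next
    case False
    have "(x + int (q ^ k * i)) mod int n = x + int (q ^ k * i)" if "i < L" for i
    proof -
      have "q ^ k * i \<le> Q ^ k * L" using q that by (intro mult_mono power_mono) auto
      then have "int (q ^ k * i) \<le> int (Q ^ k * L)" by (simp only: of_nat_le_iff)
      then have "x + int (q ^ k * i) < int n" using False x
        unfolding atLeastLessThan_iff by linarith
      then show ?thesis using x by (intro mod_pos_pos_trivial) auto
    qed
    then have "u x = (\<Sum>i<L. of_bool (x + int (q ^ k * i) \<in> A))" unfolding u_def by simp
    also have "\<dots> \<le> (\<alpha> + \<eta> / 2) * real L" using q A(2) bnd by (intro card_ap_le) auto
    finally have "u x * u x \<le> (\<alpha> + \<eta> / 2) * real L * u x" using u0 by (intro mult_right_mono)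
    then show ?thesis unfolding if_not_P[OF False] by (simp add: power2_eq_square)
  qed
  have su: "(\<Sum>x\<in>{0..<int n}. u x) = real L * real (card A)"
  proof -
    have "(\<Sum>x\<in>{0..<int n}. u x) = (\<Sum>i<L. \<Sum>x\<in>{0..<int n}. of_bool ((x + int (q ^ k * i)) mod int n \<in> A))"
      unfolding u_def by (rule sum.swap)
    also have "\<dots> = (\<Sum>i<L. real (card A))"
    proof (rule sum.cong[OF refl])
      fix i
      have "(\<Sum>x\<in>{0..<int n}. of_bool ((x + int (q ^ k * i)) mod int n \<in> A)) =
         (\<Sum>x\<in>{0..<int n}. of_bool (x mod int n \<in> A) :: real)"
        using sum_periodic_shift[OF \<open>n > 0\<close>, of "\<lambda>x. of_bool (x mod int n \<in> A)"]
        by (simp only: mod_mod_trivial)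
      then show "(\<Sum>x\<in>{0..<int n}. of_bool ((x + int (q ^ k * i)) mod int n \<in> A)) = real (card A)"
        using sum_of_bool_mod[OF A(1)] by simp
    qed
    finally show ?thesis by simp
  qed
  have sedge: "(\<Sum>x\<in>{0..<int n}. (if x \<in> {int n - int (Q ^ k * L)..<int n} then real L ^ 2 else 0))
      \<le> real L ^ 2 * (\<eta> / 2 * real n)"
  proof -
    have "(\<Sum>x\<in>{0..<int n}. (if x \<in> {int n - int (Q ^ k * L)..<int n} then real L ^ 2 else 0))
       = real (card ({0..<int n} \<inter> {int n - int (Q ^ k * L)..<int n})) * real L ^ 2"
      by (simp only: sum.inter_restrict[symmetric] finite_atLeastLessThan_int sum_constant)
    also have "\<dots> \<le> real (Q ^ k * L) * real L ^ 2"
    proof (intro mult_right_mono)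
      have "card ({0..<int n} \<inter> {int n - int (Q ^ k * L)..<int n}) \<le> card {int n - int (Q ^ k * L)..<int n}"
        by (intro card_mono) auto
      also have "\<dots> = Q ^ k * L" by (rule card_int_tail)
      finally show "real (card ({0..<int n} \<inter> {int n - int (Q ^ k * L)..<int n})) \<le> real (Q ^ k * L)"
        by (simp only: of_nat_le_iff)
    qed auto
    also have "\<dots> \<le> \<eta> / 2 * real n * real L ^ 2" by (intro mult_right_mono edge) auto
    finally show ?thesis by (simp add: mult_ac)
  qed
  have cA: "real (card A) \<le> real n"
    using card_mono[OF _ A(1)] by simp
  have "(\<Sum>x\<in>{0..<int n}. (\<Sum>i<L. of_bool ((x + int (q ^ k * i)) mod int n \<in> A) - \<alpha>)\<^sup>2)
      = (\<Sum>x\<in>{0..<int n}. (u x)\<^sup>2 - 2 * \<alpha> * real L * u x + \<alpha>\<^sup>2 * real L ^ 2)"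
    by (rule sum.cong) (simp_all add: u_def sum_subtractf power2_eq_square algebra_simps)
  also have "\<dots> = (\<Sum>x\<in>{0..<int n}. (u x)\<^sup>2) - 2 * \<alpha> * real L * (real L * real (card A)) + \<alpha>\<^sup>2 * real L ^ 2 * real n"
    by (simp add: sum.distrib sum_subtractf su flip: sum_distrib_left)
  also have "(\<Sum>x\<in>{0..<int n}. (u x)\<^sup>2) \<le> (\<alpha> + \<eta> / 2) * real L * (real L * real (card A)) + real L ^ 2 * (\<eta> / 2 * real n)"
  proof -
    have "(\<Sum>x\<in>{0..<int n}. (u x)\<^sup>2) \<le> (\<Sum>x\<in>{0..<int n}. (\<alpha> + \<eta> / 2) * real L * u x
        + (if x \<in> {int n - int (Q ^ k * L)..<int n} then real L ^ 2 else 0))"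
      by (intro sum_mono u2)
    also have "\<dots> = (\<alpha> + \<eta> / 2) * real L * (real L * real (card A))
       + (\<Sum>x\<in>{0..<int n}. (if x \<in> {int n - int (Q ^ k * L)..<int n} then real L ^ 2 else 0))"
      by (simp only: sum.distrib su sum_distrib_left[symmetric])
    finally show ?thesis using sedge by linarith
  qed
  \<comment> \<open>The terms in \<alpha> collapse to \<alpha> (\<alpha> n - |A|), which is
    nonpositive because \<open>A\<close> has density at least \<alpha>.\<close>
  also have "(\<alpha> + \<eta> / 2) * real L * (real L * real (card A)) + real L ^ 2 * (\<eta> / 2 * real n)
       - 2 * \<alpha> * real L * (real L * real (card A)) + \<alpha>\<^sup>2 * real L ^ 2 * real n
     = real L ^ 2 * (\<eta> / 2 * real (card A) + \<eta> / 2 * real n + \<alpha> * (\<alpha> * real n - real (card A)))"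
    by (simp add: power2_eq_square algebra_simps)
  also have "\<dots> \<le> real L ^ 2 * (\<eta> * real n)"
  proof (intro mult_left_mono)
    have "\<alpha> * (\<alpha> * real n - real (card A)) \<le> 0"
      using A(3) \<open>\<alpha> > 0\<close> by (simp add: mult_nonneg_nonpos)
    moreover have "\<eta> / 2 * real (card A) \<le> \<eta> / 2 * real n" using cA \<open>\<eta> > 0\<close> by (intro mult_left_mono) auto
    ultimately show "\<eta> / 2 * real (card A) + \<eta> / 2 * real n + \<alpha> * (\<alpha> * real n - real (card A)) \<le> \<eta> * real n"
      by simp
  qed auto
  finally show "(\<Sum>x\<in>{0..<int n}. (\<Sum>i<L. of_bool ((x + int (q ^ k * i)) mod int n \<in> A) - \<alpha>)\<^sup>2)
     \<le> \<eta> * real L ^ 2 * real n" by (simp add: mult_ac)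
qed

text \<open>A hit without wraparound would be a genuine power difference in \<open>A\<close>. Only
  the last D^k points can wrap, so the bound does not grow with \<open>n\<close>.\<close>

lemma power_free_correlation:
  assumes A: "A \<subseteq> {0..<int n}" "power_free k A"
  shows "(\<Sum>x\<in>A. \<Sum>d<D. of_bool ((x + (int d + 1) ^ k) mod int n \<in> A)) \<le> real (D ^ k) * real D"
proof -
  have fin: "finite A" using A(1) finite_subset by blast
  have "(\<Sum>x\<in>A. \<Sum>d<D. of_bool ((x + (int d + 1) ^ k) mod int n \<in> A)) \<le>
     (\<Sum>x\<in>A. if x \<in> {int n - int (D ^ k)..<int n} then real D else 0)"
  proof (rule sum_mono)
    fix x assume x: "x \<in> A"
    show "(\<Sum>d<D. of_bool ((x + (int d + 1) ^ k) mod int n \<in> A)) \<le>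
       (if x \<in> {int n - int (D ^ k)..<int n} then real D else 0)"
    proof (cases "x \<in> {int n - int (D ^ k)..<int n}")
      case True
      then show ?thesis
        using sum_bounded_above[of "{..<D}" "\<lambda>d. of_bool ((x + (int d + 1) ^ k) mod int n \<in> A)" "1::real"]
        by simp
    next
      case False
      have "(x + (int d + 1) ^ k) mod int n \<notin> A" if "d < D" for d
      proof -
        have "(int d + 1) ^ k \<le> int D ^ k" using that by (intro power_mono) auto
        moreover have "x < int n" "x \<ge> 0" using A(1) x by auto
        ultimately have "x + (int d + 1) ^ k < int n" using False by auto
        then have "(x + (int d + 1) ^ k) mod int n = x + (int d + 1) ^ k"
          using \<open>x \<ge> 0\<close> by (intro mod_pos_pos_trivial) auto
        then show ?thesis using A(2) x unfolding power_free_def by simp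
      qed
      then show ?thesis using False by simp
    qed
  qed
  also have "\<dots> = real (card (A \<inter> {int n - int (D ^ k)..<int n})) * real D"
    by (simp only: sum.inter_restrict[OF fin, symmetric] sum_constant)
  also have "\<dots> \<le> real (D ^ k) * real D"
  proof (intro mult_right_mono)
    have "card (A \<inter> {int n - int (D ^ k)..<int n}) \<le> card {int n - int (D ^ k)..<int n}"
      by (intro card_mono) auto
    also have "\<dots> = D ^ k" by (rule card_int_tail)
    finally show "real (card (A \<inter> {int n - int (D ^ k)..<int n})) \<le> real (D ^ k)"
      by (simp only: of_nat_le_iff)
  qed auto
  finally show ?thesis .
qed

text \<open>Parameters are fixed in the order \<alpha>, then \<open>Q\<close> and \<eta>, then
  \<open>L\<close>, \<open>D\<close>, \<open>n\<close>. The extremal \<open>A\<close> would have at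
  least \<alpha>^2 n D / 2 cyclic pairs, against a bound that does not grow with
  \<open>n\<close>.\<close>

theorem power_diff_density:
  assumes "k \<ge> 1" "\<epsilon> > 0"
  obtains M where "M > 0"
    "\<And>A. A \<subseteq> {0..<int M} \<Longrightarrow> \<epsilon> * real M \<le> real (card A) \<Longrightarrow> \<not> power_free k A"
proof (rule ccontr)
  assume "\<not> thesis"
  then have "\<And>M. M > 0 \<Longrightarrow> \<exists>A \<subseteq> {0..<int M}. power_free k A \<and> \<epsilon> * real M \<le> real (card A)"
    using that by blast
  from extremal_density[OF \<open>\<epsilon> > 0\<close> this] obtain \<alpha> where \<alpha>: "\<alpha> > 0"
    and low: "\<And>M. M > 0 \<Longrightarrow> \<exists>A \<subseteq> {0..<int M}. power_free k A \<and> \<alpha> * real M \<le> real (card A)"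
    and up: "\<And>\<eta>. \<eta> > 0 \<Longrightarrow> \<exists>L>0. \<forall>A \<subseteq> {0..<int L}. power_free k A \<longrightarrow> real (card A) \<le> (\<alpha> + \<eta>) * real L"
    by blast
  have "\<alpha> \<le> 1"
  proof -
    obtain A where "A \<subseteq> {0..<int 1}" "\<alpha> * real 1 \<le> real (card A)" using low[of 1] by auto
    moreover from this have "card A \<le> card {0..<int 1}" by (intro card_mono) auto
    ultimately show ?thesis by simp
  qed
  have "(\<alpha>\<^sup>2 / 2)\<^sup>2 > 0" using \<alpha> by simp
  \<comment> \<open>The square of \<alpha>^2 / 2 is used so that Cauchy-Schwarz leaves an error of
    half the main term \<alpha>^2 n D.\<close>
  from controlled_power[OF \<open>k \<ge> 1\<close>, unfolded controlled_def, rule_format, OF this]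
  obtain Q \<eta> where "\<eta> > 0" and ctl: "\<forall>L\<ge>1. \<exists>D\<^sub>0. \<forall>D\<ge>D\<^sub>0. \<forall>N F.
     periodic_bdd N F \<longrightarrow> ap_small k Q L \<eta> N F \<longrightarrow>
     (\<Sum>x\<in>{0..<int N}. (\<Sum>d<D. F (x + (int d + 1) ^ k))\<^sup>2) \<le> (\<alpha>\<^sup>2 / 2)\<^sup>2 * real D ^ 2 * real N" by blast
  obtain L where L: "L > 0" "\<forall>A \<subseteq> {0..<int L}. power_free k A \<longrightarrow> real (card A) \<le> (\<alpha> + \<eta> / 2) * real L"
    using up[of "\<eta> / 2"] \<open>\<eta> > 0\<close> by auto
  from L(1) have "L \<ge> 1" by simp
  from ctl[rule_format, OF this] obtain D\<^sub>0 where D\<^sub>0: "\<forall>D\<ge>D\<^sub>0. \<forall>N F.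
     periodic_bdd N F \<longrightarrow> ap_small k Q L \<eta> N F \<longrightarrow>
     (\<Sum>x\<in>{0..<int N}. (\<Sum>d<D. F (x + (int d + 1) ^ k))\<^sup>2) \<le> (\<alpha>\<^sup>2 / 2)\<^sup>2 * real D ^ 2 * real N"
    by (rule exE)
  define D where "D = max D\<^sub>0 1"
  have D: "D \<ge> D\<^sub>0" "D \<ge> 1" unfolding D_def by auto
  \<comment> \<open>With \<open>n\<close> chosen last, both wraparound losses become negligible: Q^k
    L in \<open>extremal_ap_small\<close> and D^k in \<open>power_free_correlation\<close>.\<close>
  obtain n :: nat where n: "real n > real (Q ^ k * L) / (\<eta> / 2) + real (D ^ k) / (\<alpha>\<^sup>2 / 2)"
    using reals_Archimedean2 by blast
  have nonneg: "real (Q ^ k * L) / (\<eta> / 2) \<ge> 0" "real (D ^ k) / (\<alpha>\<^sup>2 / 2) \<ge> 0"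
    using \<open>\<eta> > 0\<close> by auto
  have n0: "n > 0"
  proof (rule Nat.gr0I)
    assume "n = 0"
    with nonneg n show False by linarith
  qed
  from nonneg n have "real (Q ^ k * L) / (\<eta> / 2) < real n" "real (D ^ k) / (\<alpha>\<^sup>2 / 2) < real n" by linarith+
  then have n1: "real (Q ^ k * L) < \<eta> / 2 * real n" and n2: "real (D ^ k) < \<alpha>\<^sup>2 / 2 * real n"
    using \<open>\<eta> > 0\<close> \<alpha> by (simp_all add: pos_divide_less_eq mult.commute)
  obtain A where A: "A \<subseteq> {0..<int n}" "power_free k A" "\<alpha> * real n \<le> real (card A)"
    using low[OF n0] by blast
  \<comment> \<open>The balanced function of \<open>A\<close>; it is 1-bounded because 0 < \<alpha>
    <= 1.\<close>
  define F :: "int \<Rightarrow> real" where "F x = of_bool (x mod int n \<in> A) - \<alpha>" for x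
  have F: "periodic_bdd n F"
    unfolding periodic_bdd_def F_def using n0 \<alpha> \<open>\<alpha> \<le> 1\<close> by auto
  have "ap_small k Q L \<eta> n F"
    unfolding F_def using A \<alpha> \<open>\<eta> > 0\<close> n0 L(2) n1 by (intro extremal_ap_small) auto
  with D\<^sub>0 F D have small: "(\<Sum>x\<in>{0..<int n}. (\<Sum>d<D. F (x + (int d + 1) ^ k))\<^sup>2) \<le> (\<alpha>\<^sup>2 / 2)\<^sup>2 * real D ^ 2 * real n"
    by blast
  have cA: "real (card A) \<le> real n"
    using card_mono[OF _ A(1)] by simp
  have "\<bar>\<Sum>x\<in>A. \<Sum>d<D. F (x + (int d + 1) ^ k)\<bar> \<le> \<alpha>\<^sup>2 / 2 * real D * real n"
  proof (rule power2_le_imp_le)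
    have "\<bar>\<Sum>x\<in>A. \<Sum>d<D. F (x + (int d + 1) ^ k)\<bar>\<^sup>2 \<le> real (card A) * (\<Sum>x\<in>A. (\<Sum>d<D. F (x + (int d + 1) ^ k))\<^sup>2)"
      using sum_square_le_card[of "\<lambda>x. \<Sum>d<D. F (x + (int d + 1) ^ k)" A] by simp
    also have "\<dots> \<le> real n * ((\<alpha>\<^sup>2 / 2)\<^sup>2 * real D ^ 2 * real n)"
    proof (rule mult_mono[OF cA])
      have "(\<Sum>x\<in>A. (\<Sum>d<D. F (x + (int d + 1) ^ k))\<^sup>2) \<le> (\<Sum>x\<in>{0..<int n}. (\<Sum>d<D. F (x + (int d + 1) ^ k))\<^sup>2)"
        using A(1) by (intro sum_mono2) auto
      then show "(\<Sum>x\<in>A. (\<Sum>d<D. F (x + (int d + 1) ^ k))\<^sup>2) \<le> (\<alpha>\<^sup>2 / 2)\<^sup>2 * real D ^ 2 * real n"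
        using small by (rule order_trans)
    qed (auto intro: sum_nonneg)
    also have "\<dots> = (\<alpha>\<^sup>2 / 2 * real D * real n)\<^sup>2" by (simp add: power2_eq_square)
    finally show "\<bar>\<Sum>x\<in>A. \<Sum>d<D. F (x + (int d + 1) ^ k)\<bar>\<^sup>2 \<le> (\<alpha>\<^sup>2 / 2 * real D * real n)\<^sup>2" .
  qed (use \<alpha> in simp)
  moreover have "(\<Sum>x\<in>A. \<Sum>d<D. F (x + (int d + 1) ^ k)) =
     (\<Sum>x\<in>A. \<Sum>d<D. of_bool ((x + (int d + 1) ^ k) mod int n \<in> A)) - real (card A) * (real D * \<alpha>)"
    unfolding F_def by (simp add: sum_subtractf)
  moreover have "(\<Sum>x\<in>A. \<Sum>d<D. of_bool ((x + (int d + 1) ^ k) mod int n \<in> A)) \<le> real (D ^ k) * real D"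
    using A(1,2) by (rule power_free_correlation)
  moreover have "real (D ^ k) * real D < \<alpha>\<^sup>2 / 2 * real n * real D"
    using n2 D(2) by (intro mult_strict_right_mono) auto
  moreover have "\<alpha> * real n * (real D * \<alpha>) \<le> real (card A) * (real D * \<alpha>)"
    using A(3) \<alpha> by (intro mult_right_mono) auto
  moreover have "\<alpha> * real n * (real D * \<alpha>) = \<alpha>\<^sup>2 / 2 * real n * real D + \<alpha>\<^sup>2 / 2 * real D * real n"
    by (simp add: power2_eq_square)
  ultimately show False by linarith
qed

section \<open>Supersaturation\<close>

lemma card_shift_ge:
  assumes "U \<subseteq> {1..int n}" "c \<ge> 0"
  shows "real (card U) - real_of_int c \<le> real (card {x \<in> {1..int n}. x + c \<in> U})"
proof -
  have "U \<subseteq> {1..c} \<union> (\<lambda>x. x + c) ` {x \<in> {1..int n}. x + c \<in> U}"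
  proof
    fix y assume y: "y \<in> U"
    show "y \<in> {1..c} \<union> (\<lambda>x. x + c) ` {x \<in> {1..int n}. x + c \<in> U}"
    proof (cases "y \<le> c")
      case True
      then show ?thesis using y assms by auto
    next
      case False
      moreover have "y \<le> int n" using y assms by auto
      ultimately have "y - c \<in> {x \<in> {1..int n}. x + c \<in> U}" using y assms(2) by auto
      then show ?thesis by (intro UnI2 image_eqI[of _ _ "y - c"]) auto
    qed
  qed
  moreover have fin: "finite {x \<in> {1..int n}. x + c \<in> U}"
    by (rule finite_subset[of _ "{1..int n}"]) auto
  ultimately have "card U \<le> card ({1..c} \<union> (\<lambda>x. x + c) ` {x \<in> {1..int n}. x + c \<in> U})"
    by (intro card_mono finite_UnI finite_imageI finite_atLeastAtMost_int)
  also have "\<dots> \<le> card {1..c} + card ((\<lambda>x. x + c) ` {x \<in> {1..int n}. x + c \<in> U})"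
    by (rule card_Un_le)
  also have "card ((\<lambda>x. x + c) ` {x \<in> {1..int n}. x + c \<in> U}) \<le> card {x \<in> {1..int n}. x + c \<in> U}"
    using fin by (rule card_image_le)
  finally show ?thesis using assms(2) by simp
qed

text \<open>Double counting of the incidences between the elements of \<open>U\<close> and the progressions of length
  \<open>M\<close> and common difference \<open>s\<close>.\<close>

lemma card_rich_aps_ge:
  fixes \<epsilon> :: real
  assumes U: "U \<subseteq> {1..int n}" "\<epsilon> * real n \<le> real (card U)" and "M > 0" "s \<ge> 0"
    and s: "real_of_int s * real M \<le> \<epsilon> * real n / 4"
  shows "\<epsilon> * real n / 4 \<le> real (card {x \<in> {1..int n}. \<epsilon> / 2 * real M \<le> real (card {j \<in> {0..<int M}. x + s * j \<in> U})})"
proof -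
  define f where "f x = real (card {j \<in> {0..<int M}. x + s * j \<in> U})" for x
  define G where "G = {x \<in> {1..int n}. \<epsilon> / 2 * real M \<le> f x}"
  have "(\<Sum>x\<in>{1..int n}. f x) = (\<Sum>x\<in>{1..int n}. \<Sum>j\<in>{0..<int M}. of_bool (x + s * j \<in> U))"
    unfolding f_def by (rule sum.cong) (simp_all add: Int_def)
  also have "\<dots> = (\<Sum>j\<in>{0..<int M}. \<Sum>x\<in>{1..int n}. of_bool (x + s * j \<in> U))"
    by (rule sum.swap)
  also have "\<dots> = (\<Sum>j\<in>{0..<int M}. real (card {x \<in> {1..int n}. x + s * j \<in> U}))"
    by (rule sum.cong) (simp_all add: Int_def)
  \<comment> \<open>A shift by \<open>s * j\<close> loses at most s M <= \<epsilon> n / 4 elements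
    of \<open>U\<close>.\<close>
  also have "\<dots> \<ge> (\<Sum>j\<in>{0..<int M}. 3 / 4 * (\<epsilon> * real n))"
  proof (rule sum_mono)
    fix j assume j: "j \<in> {0..<int M}"
    have "s * j \<le> s * int M" using j \<open>s \<ge> 0\<close> by (intro mult_left_mono) auto
    then have "real_of_int (s * j) \<le> real_of_int (s * int M)" by (simp only: of_int_le_iff)
    moreover have "real (card U) - real_of_int (s * j) \<le> real (card {x \<in> {1..int n}. x + s * j \<in> U})"
      using U(1) j \<open>s \<ge> 0\<close> by (intro card_shift_ge) auto
    ultimately show "3 / 4 * (\<epsilon> * real n) \<le> real (card {x \<in> {1..int n}. x + s * j \<in> U})"
      using U(2) s by simp
  qed
  finally have low: "real M * (3 / 4 * (\<epsilon> * real n)) \<le> (\<Sum>x\<in>{1..int n}. f x)" by simp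
  have \<epsilon>: "\<epsilon> * real n \<ge> 0" using s \<open>s \<ge> 0\<close> by (smt (verit) divide_nonneg_pos mult_nonneg_nonneg of_int_nonneg of_nat_0_le_iff zero_le_divide_iff)
  \<comment> \<open>A point of \<open>G\<close> contributes at most \<open>M\<close>, any other at
    most \<epsilon> M / 2. The absolute value keeps the bound valid pointwise, since \<epsilon> may
    be negative when \<open>n = 0\<close>.\<close>
  have "(\<Sum>x\<in>{1..int n}. f x) \<le> (\<Sum>x\<in>{1..int n}. real M * of_bool (x \<in> G) + \<bar>\<epsilon>\<bar> / 2 * real M)"
  proof (rule sum_mono)
    fix x assume x: "x \<in> {1..int n}"
    have "card {j \<in> {0..<int M}. x + s * j \<in> U} \<le> card {0..<int M}" by (rule card_mono) auto
    then have fM: "f x \<le> real M" unfolding f_def by simp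
    show "f x \<le> real M * of_bool (x \<in> G) + \<bar>\<epsilon>\<bar> / 2 * real M"
    proof (cases "x \<in> G")
      case True
      then show ?thesis using fM by (simp add: add_increasing2)
    next
      case False
      then have "f x < \<epsilon> / 2 * real M" using x unfolding G_def by auto
      also have "\<dots> \<le> \<bar>\<epsilon>\<bar> / 2 * real M" by (intro mult_right_mono) auto
      finally show ?thesis using False by simp
    qed
  qed
  also have "\<dots> = real M * real (card G) + real M * (\<bar>\<epsilon>\<bar> * real n) / 2"
  proof -
    have "{1..int n} \<inter> G = G" unfolding G_def by blast
    then show ?thesis by (simp add: sum.distrib flip: sum_distrib_left)
  qed
  also have "\<bar>\<epsilon>\<bar> * real n = \<epsilon> * real n" using \<epsilon> by (simp add: abs_mult_pos flip: abs_of_nonneg)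
  finally have "real M * (\<epsilon> * real n / 4) \<le> real M * real (card G)" using low by linarith
  then have "\<epsilon> * real n / 4 \<le> real (card G)" using \<open>M > 0\<close> by simp
  then show ?thesis unfolding G_def f_def .
qed

text \<open>Varnavides' argument. For each t <= T, every rich progression of difference t^k
  contains, by the choice of \<open>M\<close>, an edge with root \<open>t * d\<close>. Each edge
  arises at most M^2 times.\<close>

lemma power_edges_ge:
  fixes \<epsilon> :: real and T M :: nat
  assumes U: "U \<subseteq> {1..int n}" "\<epsilon> * real n \<le> real (card U)" and "M > 0" "k \<ge> 1"
    and T: "real (T ^ k) * real M \<le> \<epsilon> * real n / 4"
    and M: "\<And>A. A \<subseteq> {0..<int M} \<Longrightarrow> \<epsilon> / 2 * real M \<le> real (card A) \<Longrightarrow> \<not> power_free k A"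
  shows "real T * (\<epsilon> * real n / 4) \<le> real (card (SIGMA y:U. {e. e > 0 \<and> y + e ^ k \<in> U})) * real M ^ 2"
proof -
  define G where "G t = {x \<in> {1..int n}. \<epsilon> / 2 * real M \<le> real (card {j \<in> {0..<int M}. x + t ^ k * j \<in> U})}" for t :: int
  define E where "E = (SIGMA y:U. {e. e > 0 \<and> y + e ^ k \<in> U})"
  have finU: "finite U" using U(1) finite_subset by blast
  have finG: "finite (G t)" for t
    unfolding G_def by (rule finite_subset[of _ "{1..int n}"]) auto
  \<comment> \<open>The chain e <= e^k <= n bounds the roots, so \<open>E\<close> is finite and its
    cardinality meaningful.\<close>
  have "E \<subseteq> U \<times> {0..int n}"
  proof (clarsimp simp: E_def)
    fix y e :: int assume *: "y \<in> U" "e > 0" "y + e ^ k \<in> U"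
    then have "1 \<le> y" "y + e ^ k \<le> int n" using U(1) by auto
    moreover have "e \<le> e ^ k" using * \<open>k \<ge> 1\<close> by (intro self_le_power) auto
    ultimately show "e \<le> int n" by linarith
  qed
  then have finE: "finite E" using finU finite_subset by blast
  have G: "\<epsilon> * real n / 4 \<le> real (card (G t))" if t: "t \<in> {1..int T}" for t
    unfolding G_def
  proof (rule card_rich_aps_ge[OF U \<open>M > 0\<close>])
    have "t ^ k \<le> int T ^ k" using t by (intro power_mono) auto
    then have "real_of_int (t ^ k) \<le> real_of_int (int T ^ k)" by (simp only: of_int_le_iff)
    then have "real_of_int (t ^ k) * real M \<le> real (T ^ k) * real M"
      by (intro mult_right_mono) simp_all
    then show "real_of_int (t ^ k) * real M \<le> \<epsilon> * real n / 4" using T by linarith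
  qed (use t in simp)
  define P where "P t x a d \<longleftrightarrow> 0 < d \<and> d < int M \<and> 0 \<le> a \<and> a < int M \<and> x + t ^ k * a \<in> U
      \<and> (x + t ^ k * a) + (t * d) ^ k \<in> U" for t x a d
  have P: "\<exists>w. P t x (fst w) (snd w)" if "x \<in> G t" for t x
  proof -
    have "\<not> power_free k {j \<in> {0..<int M}. x + t ^ k * j \<in> U}"
      using that unfolding G_def by (intro M) auto
    then obtain a d where ad: "d > 0" "a \<in> {j \<in> {0..<int M}. x + t ^ k * j \<in> U}"
        "a + d ^ k \<in> {j \<in> {0..<int M}. x + t ^ k * j \<in> U}"
      unfolding power_free_def by blast
    \<comment> \<open>Since \<open>d ^ k\<close> is below \<open>M\<close>, so is \<open>d\<close>;
      both labels thus range over at most \<open>M\<close> values.\<close>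
    have "d \<le> d ^ k" using ad(1) \<open>k \<ge> 1\<close> by (intro self_le_power) auto
    then have "P t x a d" using ad unfolding P_def by (auto simp: algebra_simps power_mult_distrib)
    then show ?thesis by (intro exI[of _ "(a, d)"]) simp
  qed
  define a where "a t x = fst (SOME w. P t x (fst w) (snd w))" for t x
  define d where "d t x = snd (SOME w. P t x (fst w) (snd w))" for t x
  have ad: "P t x (a t x) (d t x)" if "x \<in> G t" for t x
    using someI_ex[OF P[OF that]] unfolding a_def d_def .
  \<comment> \<open>The labels make \<phi> injective: \<open>t * d\<close> and \<open>d\<close>
    determine \<open>t\<close>, and then the lower endpoint and \<open>a\<close> determine
    \<open>x\<close>.\<close>
  define \<phi> where "\<phi> = (\<lambda>(t, x). ((x + t ^ k * a t x, t * d t x), a t x, d t x))"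
  have "card (SIGMA t:{1..int T}. G t) \<le> card (E \<times> {0..<int M} \<times> {0..<int M})"
  proof (rule card_inj_on_le)
    show "inj_on \<phi> (SIGMA t:{1..int T}. G t)"
    proof (rule inj_onI)
      fix p p' assume p: "p \<in> (SIGMA t:{1..int T}. G t)" "p' \<in> (SIGMA t:{1..int T}. G t)" and eq: "\<phi> p = \<phi> p'"
      obtain t x t' x' where [simp]: "p = (t, x)" "p' = (t', x')" by (cases p, cases p')
      from eq have eqs: "x + t ^ k * a t x = x' + t' ^ k * a t' x'" "t * d t x = t' * d t' x'"
        "a t x = a t' x'" "d t x = d t' x'" unfolding \<phi>_def by auto
      have "d t x > 0" using p(1) ad[of x t] unfolding P_def by simp
      then have "t = t'" using eqs(2,4) by simp
      then show "p = p'" using eqs(1,3) by simp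
    qed
    show "\<phi> ` (SIGMA t:{1..int T}. G t) \<subseteq> E \<times> {0..<int M} \<times> {0..<int M}"
    proof (rule image_subsetI)
      fix p assume "p \<in> (SIGMA t:{1..int T}. G t)"
      then obtain t x where p: "p = (t, x)" "1 \<le> t" "x \<in> G t" by auto
      then show "\<phi> p \<in> E \<times> {0..<int M} \<times> {0..<int M}"
        using ad[OF p(3)] unfolding \<phi>_def E_def P_def by simp
    qed
  qed (use finE in simp)
  also have "\<dots> = card E * M ^ 2" by (simp add: card_cartesian_product power2_eq_square)
  finally have "(\<Sum>t\<in>{1..int T}. card (G t)) \<le> card E * M ^ 2"
    using finG by (subst card_SigmaI[symmetric]) auto
  then have "(\<Sum>t\<in>{1..int T}. real (card (G t))) \<le> real (card E) * real M ^ 2"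
    by (metis of_nat_le_iff of_nat_mult of_nat_power of_nat_sum)
  moreover have "(\<Sum>t\<in>{1..int T}. \<epsilon> * real n / 4) \<le> (\<Sum>t\<in>{1..int T}. real (card (G t)))"
    using G by (rule sum_mono)
  ultimately show ?thesis unfolding E_def by simp
qed

text \<open>Some upward degree reaches the average over \<open>U\<close>, and \<open>U\<close> has
  at most \<open>n\<close> points. Taking \<open>k\<close>-th powers is injective on positive
  integers, so neighbours above \<open>x\<close> and roots are equally many.\<close>

lemma power_degree_ge:
  fixes \<epsilon> :: real and T M :: nat
  assumes U: "U \<subseteq> {1..int n}" "\<epsilon> * real n \<le> real (card U)" and "M > 0" "k \<ge> 1" "\<epsilon> > 0" "n > 0"
    and T: "real (T ^ k) * real M \<le> \<epsilon> * real n / 4"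
    and M: "\<And>A. A \<subseteq> {0..<int M} \<Longrightarrow> \<epsilon> / 2 * real M \<le> real (card A) \<Longrightarrow> \<not> power_free k A"
  obtains x where "x \<in> U" "\<epsilon> * real T / (4 * real M ^ 2) \<le> real (card {y \<in> U. \<exists>d>0. y = x + d ^ k})"
proof (rule ccontr)
  assume "\<not> thesis"
  with that have no: "\<not> (x \<in> U \<and> \<epsilon> * real T / (4 * real M ^ 2) \<le> real (card {y \<in> U. \<exists>d>0. y = x + d ^ k}))" for x
    by blast
  define \<Delta> where "\<Delta> = \<epsilon> * real T / (4 * real M ^ 2)"
  define E where "E y = {e. e > 0 \<and> y + e ^ k \<in> U}" for y
  have finU: "finite U" using U(1) finite_subset by blast
  have E: "bij_betw (\<lambda>e. x + e ^ k) (E x) {y \<in> U. \<exists>d>0. y = x + d ^ k}" for x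
  proof (rule bij_betwI')
    fix d e assume "d \<in> E x" "e \<in> E x"
    then show "x + d ^ k = x + e ^ k \<longleftrightarrow> d = e"
      using \<open>k \<ge> 1\<close> power_eq_iff_eq_base[of k d e] unfolding E_def by simp
  qed (auto simp: E_def)
  have finE: "finite (E x)" for x using bij_betw_finite[OF E] finU by simp
  have lt: "real (card (E x)) < \<Delta>" if x: "x \<in> U" for x
  proof (rule ccontr)
    assume "\<not> real (card (E x)) < \<Delta>"
    then have "\<Delta> \<le> real (card {y \<in> U. \<exists>d>0. y = x + d ^ k})"
      using bij_betw_same_card[OF E, of x] by simp
    then show False using no x unfolding \<Delta>_def by blast
  qed
  have "\<epsilon> * real n > 0" using assms by simp
  then have "U \<noteq> {}" using U(2) by auto
  have "real (card (SIGMA y:U. E y)) = (\<Sum>y\<in>U. real (card (E y)))"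
    using finU finE by (subst card_SigmaI) auto
  also have "\<dots> < (\<Sum>y\<in>U. \<Delta>)" using lt \<open>U \<noteq> {}\<close> finU by (intro sum_strict_mono) auto
  also have "\<dots> = real (card U) * \<Delta>" by simp
  also have "\<dots> \<le> real n * \<Delta>"
  proof (rule mult_right_mono)
    show "real (card U) \<le> real n" using card_mono[OF _ U(1)] by simp
    show "\<Delta> \<ge> 0" using \<open>\<epsilon> > 0\<close> unfolding \<Delta>_def by simp
  qed
  finally have "real (card (SIGMA y:U. E y)) * real M ^ 2 < real n * \<Delta> * real M ^ 2"
    using \<open>M > 0\<close> by (intro mult_strict_right_mono) auto
  also have "\<dots> = real T * (\<epsilon> * real n / 4)" unfolding \<Delta>_def using \<open>M > 0\<close> by (simp add: field_simps)
  finally show False using power_edges_ge[OF U \<open>M > 0\<close> \<open>k \<ge> 1\<close> T M] unfolding E_def by linarith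
qed

text \<open>\<open>T\<close> is the largest integer with T^k M <= \<epsilon> n / 4. It has order
  n^(1/k) because \<open>M\<close> does not depend on \<open>n\<close>.\<close>

theorem power_supersaturation:
  fixes \<epsilon> :: real
  assumes "k \<ge> 1" "\<epsilon> > 0"
  obtains c n\<^sub>0 where "c > 0" "\<And>n U. n \<ge> n\<^sub>0 \<Longrightarrow> U \<subseteq> {1..int n} \<Longrightarrow> \<epsilon> * real n \<le> real (card U) \<Longrightarrow>
    \<exists>x\<in>U. c * real n powr (1 / real k) \<le> real (card {y \<in> U. \<exists>d>0. y = x + d ^ k})"
proof -
  have "\<epsilon> / 2 > 0" using assms by simp
  from power_diff_density[OF \<open>k \<ge> 1\<close> this] obtain M where "M > 0" and
    M: "\<And>A. A \<subseteq> {0..<int M} \<Longrightarrow> \<epsilon> / 2 * real M \<le> real (card A) \<Longrightarrow> \<not> power_free k A" by blast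
  define \<gamma> where "\<gamma> = \<epsilon> / (4 * real M)"
  have "\<gamma> > 0" unfolding \<gamma>_def using \<open>M > 0\<close> \<open>\<epsilon> > 0\<close> by simp
  \<comment> \<open>The factor 1/2 pays for rounding (\<gamma> n)^(1/k) down to \<open>T\<close>;
    this is enough once \<gamma> n >= 1, which \<open>n\<^sub>0\<close> ensures.\<close>
  define c where "c = \<epsilon> / (4 * real M ^ 2) * (\<gamma> powr (1 / real k) / 2)"
  obtain n\<^sub>0 :: nat where n0: "real n\<^sub>0 \<ge> 1 / \<gamma>" using real_arch_simple by blast
  have "c > 0" unfolding c_def using \<open>M > 0\<close> \<open>\<epsilon> > 0\<close> \<open>\<gamma> > 0\<close> by simp
  moreover have "\<exists>x\<in>U. c * real n powr (1 / real k) \<le> real (card {y \<in> U. \<exists>d>0. y = x + d ^ k})"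
    if n: "n \<ge> n\<^sub>0" and U: "U \<subseteq> {1..int n}" "\<epsilon> * real n \<le> real (card U)" for n U
  proof -
    have "1 / \<gamma> \<le> real n" using n0 n by linarith
    then have n1: "1 \<le> \<gamma> * real n" using \<open>\<gamma> > 0\<close> by (simp add: field_simps)
    then have "n > 0" by (intro Nat.gr0I) auto
    define z where "z = (\<gamma> * real n) powr (1 / real k)"
    have z1: "z \<ge> 1" unfolding z_def using n1 by (intro ge_one_powr_ge_zero) auto
    define T where "T = nat \<lfloor>z\<rfloor>"
    have T: "real T \<le> z" "z / 2 \<le> real T"
    proof -
      have "1 \<le> \<lfloor>z\<rfloor>" using z1 by simp
      then have "real T = real_of_int \<lfloor>z\<rfloor>" unfolding T_def by simp
      moreover have "1 \<le> real_of_int \<lfloor>z\<rfloor>" using \<open>1 \<le> \<lfloor>z\<rfloor>\<close> by linarith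
      ultimately show "real T \<le> z" "z / 2 \<le> real T" by linarith+
    qed
    have "real (T ^ k) \<le> z ^ k" using T(1) by (simp add: power_mono)
    also have "\<dots> = \<gamma> * real n"
      unfolding z_def using \<open>k \<ge> 1\<close> \<open>\<gamma> > 0\<close> \<open>n > 0\<close>
      by (simp add: powr_powr flip: powr_realpow)
    finally have "real (T ^ k) * real M \<le> \<gamma> * real n * real M" by (intro mult_right_mono) auto
    also have "\<dots> = \<epsilon> * real n / 4" unfolding \<gamma>_def using \<open>M > 0\<close> by simp
    finally have TM: "real (T ^ k) * real M \<le> \<epsilon> * real n / 4" .
    obtain x where x: "x \<in> U" "\<epsilon> * real T / (4 * real M ^ 2) \<le> real (card {y \<in> U. \<exists>d>0. y = x + d ^ k})"
      using power_degree_ge[OF U \<open>M > 0\<close> \<open>k \<ge> 1\<close> \<open>\<epsilon> > 0\<close> \<open>n > 0\<close> TM M] by blast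
    have "c * real n powr (1 / real k) = \<epsilon> / (4 * real M ^ 2) * (z / 2)"
      unfolding c_def z_def using \<open>\<gamma> > 0\<close> by (simp add: powr_mult)
    also have "\<dots> \<le> \<epsilon> / (4 * real M ^ 2) * real T"
      using T(2) \<open>\<epsilon> > 0\<close> by (intro mult_left_mono) auto
    finally show ?thesis using x by (intro bexI[of _ x]) simp_all
  qed
  ultimately show ?thesis by (rule that)
qed

section \<open>Containers and counting\<close>

text \<open>Kleitman-Winston as a recursion on \<open>V\<close>. Above size \<open>K\<close>, pick a
  vertex \<open>x\<close> of large degree: if \<open>x\<close> is not in \<open>I\<close>, delete
  it; otherwise put it into the fingerprint \<open>S\<close> and delete its neighbours too. The
  second case removes at least \<Delta> vertices, so it occurs at most |V| / \<Delta> times.\<close>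

lemma container_exists:
  fixes \<Delta> K :: real
  assumes "finite V" "\<Delta> > 0" and irr: "\<And>x. \<not> adj x x"
    and deg: "\<And>U. U \<subseteq> V \<Longrightarrow> K < real (card U) \<Longrightarrow> \<exists>x\<in>U. \<Delta> \<le> real (card {y \<in> U. adj x y})"
  shows "\<exists>C. \<forall>I. I \<subseteq> V \<longrightarrow> (\<forall>x\<in>I. \<forall>y\<in>I. \<not> adj x y) \<longrightarrow>
    (\<exists>S\<subseteq>I. real (card S) * \<Delta> \<le> real (card V) \<and> C S \<subseteq> V \<and> real (card (C S)) \<le> K \<and> I \<subseteq> S \<union> C S)"
  using assms(1) deg
proof (induction "card V" arbitrary: V rule: less_induct)
  case less
  show ?case
  proof (cases "real (card V) \<le> K")
    case True
    then show ?thesis by (intro exI[of _ "\<lambda>_. V"] allI impI exI[of _ "{}"]) auto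
  next
    case False
    then obtain x where x: "x \<in> V" and dx: "\<Delta> \<le> real (card {y \<in> V. adj x y})"
      using less.prems(2)[of V] by auto
    define N where "N = {y \<in> V. adj x y}"
    define V1 where "V1 = V - {x}"
    define V2 where "V2 = V - {x} - N"
    have c1: "card V1 < card V" unfolding V1_def using x less.prems(1) by (intro psubset_card_mono) auto
    have c2: "card V2 < card V" unfolding V2_def using x less.prems(1) by (intro psubset_card_mono) auto
    have "card V2 + card N = card (V2 \<union> N)"
      using less.prems(1) unfolding V2_def N_def by (intro card_Un_disjoint[symmetric]) auto
    also have "\<dots> \<le> card V" using less.prems(1) unfolding V2_def N_def by (intro card_mono) auto
    finally have c3: "card V2 + card N \<le> card V" .
    have V12: "V1 \<subseteq> V" "V2 \<subseteq> V" unfolding V1_def V2_def by auto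
    have "\<exists>C. \<forall>I. I \<subseteq> V1 \<longrightarrow> (\<forall>x\<in>I. \<forall>y\<in>I. \<not> adj x y) \<longrightarrow>
      (\<exists>S\<subseteq>I. real (card S) * \<Delta> \<le> real (card V1) \<and> C S \<subseteq> V1 \<and> real (card (C S)) \<le> K \<and> I \<subseteq> S \<union> C S)"
      using c1 V12 less.prems by (intro less.hyps) (auto intro: finite_subset)
    then obtain C1 where C1: "\<And>I. I \<subseteq> V1 \<Longrightarrow> (\<forall>x\<in>I. \<forall>y\<in>I. \<not> adj x y) \<Longrightarrow>
      (\<exists>S\<subseteq>I. real (card S) * \<Delta> \<le> real (card V1) \<and> C1 S \<subseteq> V1 \<and> real (card (C1 S)) \<le> K \<and> I \<subseteq> S \<union> C1 S)"
      by blast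
    have "\<exists>C. \<forall>I. I \<subseteq> V2 \<longrightarrow> (\<forall>x\<in>I. \<forall>y\<in>I. \<not> adj x y) \<longrightarrow>
      (\<exists>S\<subseteq>I. real (card S) * \<Delta> \<le> real (card V2) \<and> C S \<subseteq> V2 \<and> real (card (C S)) \<le> K \<and> I \<subseteq> S \<union> C S)"
      using c2 V12 less.prems by (intro less.hyps) (auto intro: finite_subset)
    then obtain C2 where C2: "\<And>I. I \<subseteq> V2 \<Longrightarrow> (\<forall>x\<in>I. \<forall>y\<in>I. \<not> adj x y) \<Longrightarrow>
      (\<exists>S\<subseteq>I. real (card S) * \<Delta> \<le> real (card V2) \<and> C2 S \<subseteq> V2 \<and> real (card (C2 S)) \<le> K \<and> I \<subseteq> S \<union> C2 S)"
      by blast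
    \<comment> \<open>The branch can be read off from \<open>S\<close>, since \<open>x\<close> will
      lie in \<open>S\<close> exactly when it lies in \<open>I\<close>; hence the container depends
      on \<open>S\<close> alone.\<close>
    define C where "C S = (if x \<in> S then C2 (S - {x}) else C1 S)" for S
    show ?thesis
    proof (intro exI[of _ C] allI impI)
      fix I assume I: "I \<subseteq> V" "\<forall>x\<in>I. \<forall>y\<in>I. \<not> adj x y"
      show "\<exists>S\<subseteq>I. real (card S) * \<Delta> \<le> real (card V) \<and> C S \<subseteq> V \<and> real (card (C S)) \<le> K \<and> I \<subseteq> S \<union> C S"
      proof (cases "x \<in> I")
        case False
        then have "I \<subseteq> V1" using I(1) unfolding V1_def by blast
        from C1[OF this I(2)] obtain S where S: "S \<subseteq> I" "real (card S) * \<Delta> \<le> real (card V1)"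
          "C1 S \<subseteq> V1" "real (card (C1 S)) \<le> K" "I \<subseteq> S \<union> C1 S" by blast
        have "C S = C1 S" using False S(1) unfolding C_def by auto
        moreover have "real (card V1) \<le> real (card V)" using c1 by simp
        ultimately show ?thesis using S V12 by (intro exI[of _ S]) auto
      next
        case True
        have I2: "I - {x} \<subseteq> V2" using I True unfolding V2_def N_def by blast
        have "\<forall>y\<in>I - {x}. \<forall>z\<in>I - {x}. \<not> adj y z" using I(2) by blast
        from C2[OF I2 this] obtain S where S: "S \<subseteq> I - {x}" "real (card S) * \<Delta> \<le> real (card V2)"
          "C2 S \<subseteq> V2" "real (card (C2 S)) \<le> K" "I - {x} \<subseteq> S \<union> C2 S" by blast
        have xS: "x \<notin> S" using S(1) by blast
        then have CS: "C (insert x S) = C2 S" unfolding C_def by simp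
        have "finite S" using S(1) I(1) less.prems(1) by (meson Diff_subset finite_subset)
        then have "real (card (insert x S)) * \<Delta> = \<Delta> + real (card S) * \<Delta>"
          using xS by (simp add: distrib_right)
        also have "\<dots> \<le> real (card N) + real (card V2)" using dx S(2) unfolding N_def by linarith
        also have "\<dots> \<le> real (card V)" using c3 by simp
        finally have "real (card (insert x S)) * \<Delta> \<le> real (card V)" .
        then show ?thesis using S V12 True CS by (intro exI[of _ "insert x S"]) auto
      qed
    qed
  qed
qed

section \<open>Counting sets that contain a bad subset\<close>

text \<open>Each further factor of the quotient of the binomials is (r - m)/(n - m) <= r/n; clearing
  denominators keeps everything in the naturals.\<close>

lemma binomial_ratio_le:
  assumes "r \<le> n"
  shows "(r choose m) * n ^ m \<le> (n choose m) * r ^ m"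
proof (induction m)
  case (Suc m)
  have eq: "Suc m * (a choose Suc m) = (a choose m) * (a - m)" for a :: nat
    using binomial_absorption[of m a] binomial_absorb_comp[of a m] by (simp only: mult.commute)
  have "(r - m) * n \<le> r * (n - m)"
    using assms by (simp add: diff_mult_distrib diff_mult_distrib2 mult.commute diff_le_mono2)
  then have "((r choose m) * n ^ m) * ((r - m) * n) \<le> ((n choose m) * r ^ m) * (r * (n - m))"
    by (rule mult_le_mono[OF Suc])
  moreover have "Suc m * ((r choose Suc m) * n ^ Suc m) = ((r choose m) * n ^ m) * ((r - m) * n)"
    using arg_cong[OF eq[of r], of "\<lambda>x. x * (n ^ m * n)"] by (simp only: power_Suc mult_ac)
  moreover have "Suc m * ((n choose Suc m) * r ^ Suc m) = ((n choose m) * r ^ m) * (r * (n - m))"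
    using arg_cong[OF eq[of n], of "\<lambda>x. x * (r ^ m * r)"] by (simp only: power_Suc mult_ac)
  ultimately have "Suc m * ((r choose Suc m) * n ^ Suc m) \<le> Suc m * ((n choose Suc m) * r ^ Suc m)"
    by simp
  then show ?case by (simp only: Suc_mult_le_cancel1)
qed simp

text \<open>Serves to bound by (r/n)^m the proportion of \<open>r\<close>-sets that contain a fixed
  \<open>m\<close>-set.\<close>

lemma binomial_superset_ratio_le:
  assumes "r \<le> n" "m \<le> r"
  shows "((n - m) choose (r - m)) * n ^ m \<le> (n choose r) * r ^ m"
proof -
  have "(n choose m) * (((n - m) choose (r - m)) * n ^ m) = (n choose r) * ((r choose m) * n ^ m)"
    using arg_cong[OF choose_mult[OF assms(2,1)], of "\<lambda>x. x * n ^ m"] by (simp only: mult.assoc)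
  also have "\<dots> \<le> (n choose r) * ((n choose m) * r ^ m)"
    by (rule mult_le_mono2[OF binomial_ratio_le[OF assms(1)]])
  finally have "(n choose m) * (((n - m) choose (r - m)) * n ^ m) \<le> (n choose m) * ((n choose r) * r ^ m)"
    by (simp only: mult.left_commute)
  moreover have "n choose m > 0" using assms by simp
  ultimately show ?thesis by simp
qed

lemma card_supersets_le:
  assumes "finite V" "B \<subseteq> V"
  shows "card {R. B \<subseteq> R \<and> R \<subseteq> V \<and> card R = r} \<le> (card V - card B) choose (r - card B)"
proof -
  define W where "W = {Y. Y \<subseteq> V - B \<and> card Y = r - card B}"
  have finB: "finite B" by (rule finite_subset[OF assms(2,1)])
  have finW: "finite W" unfolding W_def by (rule finite_subset[of _ "Pow (V - B)"]) (use assms(1) in auto)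
  have "{R. B \<subseteq> R \<and> R \<subseteq> V \<and> card R = r} \<subseteq> (\<lambda>Y. B \<union> Y) ` W"
  proof
    fix R assume "R \<in> {R. B \<subseteq> R \<and> R \<subseteq> V \<and> card R = r}"
    then have R: "B \<subseteq> R" "R \<subseteq> V" "card R = r" by auto
    have "card (R - B) = r - card B" unfolding card_Diff_subset[OF finB R(1)] R(3) ..
    moreover have "R - B \<subseteq> V - B" using R(2) by blast
    ultimately have "R - B \<in> W" unfolding W_def by simp
    moreover have "R = B \<union> (R - B)" using R(1) by blast
    ultimately show "R \<in> (\<lambda>Y. B \<union> Y) ` W" by (rule rev_image_eqI)
  qed
  then have "card {R. B \<subseteq> R \<and> R \<subseteq> V \<and> card R = r} \<le> card W"
    by (rule surj_card_le[OF finW])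
  also have "\<dots> = (card V - card B) choose (r - card B)"
    unfolding W_def using assms n_subsets[of "V - B"] card_Diff_subset[OF finB assms(2)] by simp
  finally show ?thesis .
qed

text \<open>\<open>B\<close> is determined by \<open>S\<close> and \<open>B - S\<close>, and the
  latter is a subset of \<open>C S\<close> with \<open>m - s\<close> elements.\<close>

lemma card_union_subsets_le:
  assumes "finite V" "\<And>S. finite (C S)"
  shows "card {B. B \<subseteq> V \<and> card B = m \<and> (\<exists>S\<subseteq>B. card S = s \<and> B \<subseteq> S \<union> C S)}
     \<le> (\<Sum>S | S \<subseteq> V \<and> card S = s. card (C S) choose (m - s))"
proof -
  have "{B. B \<subseteq> V \<and> card B = m \<and> (\<exists>S\<subseteq>B. card S = s \<and> B \<subseteq> S \<union> C S)} \<subseteq>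
    (\<Union>S\<in>{S. S \<subseteq> V \<and> card S = s}. (\<lambda>Y. S \<union> Y) ` {Y. Y \<subseteq> C S \<and> card Y = m - s})"
  proof
    fix B assume "B \<in> {B. B \<subseteq> V \<and> card B = m \<and> (\<exists>S\<subseteq>B. card S = s \<and> B \<subseteq> S \<union> C S)}"
    then obtain S where B: "B \<subseteq> V" "card B = m" "S \<subseteq> B" "card S = s" "B \<subseteq> S \<union> C S" by blast
    have "finite S" by (rule finite_subset[OF B(3) finite_subset[OF B(1) assms(1)]])
    then have "card (B - S) = m - s" using B by (simp add: card_Diff_subset)
    moreover have "B - S \<subseteq> C S" "B = S \<union> (B - S)" "S \<subseteq> V" using B by auto
    ultimately show "B \<in> (\<Union>S\<in>{S. S \<subseteq> V \<and> card S = s}. (\<lambda>Y. S \<union> Y) ` {Y. Y \<subseteq> C S \<and> card Y = m - s})"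
      using B(4) by (intro UN_I[of S] image_eqI[of _ _ "B - S"]) simp_all
  qed
  moreover have finS: "finite {S. S \<subseteq> V \<and> card S = s}"
    by (rule finite_subset[of _ "Pow V"]) (use assms(1) in auto)
  moreover have finY: "finite {Y. Y \<subseteq> C S \<and> card Y = m - s}" for S
    by (rule finite_subset[of _ "Pow (C S)"]) (use assms(2)[of S] in auto)
  ultimately have "card {B. B \<subseteq> V \<and> card B = m \<and> (\<exists>S\<subseteq>B. card S = s \<and> B \<subseteq> S \<union> C S)} \<le>
     card (\<Union>S\<in>{S. S \<subseteq> V \<and> card S = s}. (\<lambda>Y. S \<union> Y) ` {Y. Y \<subseteq> C S \<and> card Y = m - s})"
    by (intro card_mono finite_UN_I finite_imageI)
  also have "\<dots> \<le> (\<Sum>S\<in>{S. S \<subseteq> V \<and> card S = s}. card ((\<lambda>Y. S \<union> Y) ` {Y. Y \<subseteq> C S \<and> card Y = m - s}))"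
    by (rule card_UN_le[OF finS])
  also have "\<dots> \<le> (\<Sum>S\<in>{S. S \<subseteq> V \<and> card S = s}. card {Y. Y \<subseteq> C S \<and> card Y = m - s})"
    using finY by (intro sum_mono card_image_le)
  also have "\<dots> = (\<Sum>S\<in>{S. S \<subseteq> V \<and> card S = s}. card (C S) choose (m - s))"
    using assms(2) by (simp add: n_subsets)
  finally show ?thesis .
qed

lemma binomial_fact_le_real:
  assumes "real a \<le> b"
  shows "real (a choose j) * fact j \<le> b ^ j"
proof -
  have "real ((a choose j) * fact j) \<le> real (a ^ j)"
    by (simp only: of_nat_le_iff binomial_fact_pow)
  also have "\<dots> \<le> b ^ j" using assms by (simp add: power_mono)
  finally show ?thesis by simp
qed

text \<open>With at most \<open>m / 2\<close> elements in the fingerprint \<open>S\<close>, at least half of \<open>B\<close> lies in the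
  container \<open>C S\<close>; this produces the factor \<open>\<sigma> ^ m\<close>.\<close>

lemma card_contained_le:
  fixes \<sigma> :: real
  assumes V: "finite V" and C: "\<And>S. finite (C S)" "\<And>S. real (card (C S)) \<le> \<sigma>\<^sup>2 * real (card V)"
    and \<sigma>: "0 \<le> \<sigma>" "\<sigma> \<le> 1"
  shows "real (card {B. B \<subseteq> V \<and> card B = m \<and> (\<exists>S\<subseteq>B. 2 * card S \<le> m \<and> B \<subseteq> S \<union> C S)}) * fact m
     \<le> (2 * \<sigma> * real (card V)) ^ m"
proof -
  define n where "n = card V"
  define X where "X s = {B. B \<subseteq> V \<and> card B = m \<and> (\<exists>S\<subseteq>B. card S = s \<and> B \<subseteq> S \<union> C S)}" for s
  have X: "real (card (X s)) * fact m \<le> real (m choose s) * (\<sigma> ^ m * real n ^ m)" if s: "2 * s \<le> m" for s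
  proof -
    have "real (card (X s)) \<le> real (\<Sum>S | S \<subseteq> V \<and> card S = s. card (C S) choose (m - s))"
      unfolding X_def of_nat_le_iff using V C(1) by (rule card_union_subsets_le)
    then have "real (card (X s)) * (fact s * fact (m - s)) \<le>
       (\<Sum>S | S \<subseteq> V \<and> card S = s. real (card (C S) choose (m - s))) * (fact s * fact (m - s))"
      by (intro mult_right_mono) simp_all
    also have "\<dots> = fact s * (\<Sum>S | S \<subseteq> V \<and> card S = s. real (card (C S) choose (m - s)) * fact (m - s))"
      by (simp add: sum_distrib_right sum_distrib_left mult_ac)
    also have "\<dots> \<le> fact s * (\<Sum>S | S \<subseteq> V \<and> card S = s. (\<sigma>\<^sup>2 * real n) ^ (m - s))"
      unfolding n_def using C(2) by (intro mult_left_mono sum_mono binomial_fact_le_real) auto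
    also have "\<dots> = (real (n choose s) * fact s) * (\<sigma>\<^sup>2 * real n) ^ (m - s)"
      using V by (simp add: n_subsets n_def)
    also have "\<dots> \<le> real n ^ s * (\<sigma>\<^sup>2 * real n) ^ (m - s)"
      by (intro mult_right_mono binomial_fact_le_real) auto
    also have "\<dots> = \<sigma> ^ (2 * (m - s)) * real n ^ m"
      using s by (simp add: power_mult_distrib power_mult flip: power_add)
    \<comment> \<open>Here 2 (m - s) >= m and \<sigma> <= 1; this is why the container bound has the
      form \<sigma>^2 |V|.\<close>
    also have "\<dots> \<le> \<sigma> ^ m * real n ^ m"
      using \<sigma> s by (intro mult_right_mono power_decreasing) auto
    finally have *: "real (card (X s)) * (fact s * fact (m - s)) \<le> \<sigma> ^ m * real n ^ m" .
    \<comment> \<open>Multiplying by m! turns the two factorials into a binomial coefficient, and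
      summing over \<open>s\<close> later costs only 2^m.\<close>
    have "fact m = fact s * fact (m - s) * real (m choose s)"
    proof -
      have "real (fact s * fact (m - s) * (m choose s)) = real (fact m)"
        using binomial_fact_lemma[of s m] s by simp
      then show ?thesis by simp
    qed
    then have "real (card (X s)) * fact m = real (m choose s) * (real (card (X s)) * (fact s * fact (m - s)))"
      by simp
    also have "\<dots> \<le> real (m choose s) * (\<sigma> ^ m * real n ^ m)"
      using * by (intro mult_left_mono) auto
    finally show ?thesis .
  qed
  have "{B. B \<subseteq> V \<and> card B = m \<and> (\<exists>S\<subseteq>B. 2 * card S \<le> m \<and> B \<subseteq> S \<union> C S)} = (\<Union>s\<in>{s. 2 * s \<le> m}. X s)"
    unfolding X_def by blast
  moreover have finS: "finite {s. 2 * s \<le> m}" by (rule finite_subset[of _ "{..m}"]) auto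
  ultimately have "card {B. B \<subseteq> V \<and> card B = m \<and> (\<exists>S\<subseteq>B. 2 * card S \<le> m \<and> B \<subseteq> S \<union> C S)} \<le> (\<Sum>s\<in>{s. 2 * s \<le> m}. card (X s))"
    by (simp add: card_UN_le)
  then have "real (card {B. B \<subseteq> V \<and> card B = m \<and> (\<exists>S\<subseteq>B. 2 * card S \<le> m \<and> B \<subseteq> S \<union> C S)}) * fact m
     \<le> real (\<Sum>s\<in>{s. 2 * s \<le> m}. card (X s)) * fact m"
    by (intro mult_right_mono) (simp_all only: of_nat_le_iff fact_ge_zero)
  also have "\<dots> = (\<Sum>s\<in>{s. 2 * s \<le> m}. real (card (X s)) * fact m)"
    by (simp add: sum_distrib_right)
  also have "\<dots> \<le> (\<Sum>s\<in>{s. 2 * s \<le> m}. real (m choose s) * (\<sigma> ^ m * real n ^ m))"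
    using X by (intro sum_mono) auto
  also have "\<dots> \<le> (\<Sum>s\<in>{..m}. real (m choose s) * (\<sigma> ^ m * real n ^ m))"
    using \<sigma> by (intro sum_mono2) auto
  also have "\<dots> = real (\<Sum>s\<in>{..m}. m choose s) * (\<sigma> ^ m * real n ^ m)"
    by (simp add: sum_distrib_right)
  also have "\<dots> = (2 * \<sigma> * real n) ^ m"
    by (simp add: choose_row_sum power_mult_distrib)
  finally show ?thesis unfolding n_def .
qed

text \<open>A union bound over the bad \<open>m\<close>-sets: there are at most (2 \<sigma> n)^m /
  m! of them, and each lies in at most a fraction (r/n)^m of the \<open>r\<close>-sets, so
  \<open>n\<close> cancels.\<close>

lemma card_bad_subsets_le:
  fixes \<sigma> :: real
  assumes V: "finite V" and C: "\<And>S. finite (C S)" "\<And>S. real (card (C S)) \<le> \<sigma>\<^sup>2 * real (card V)"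
    and \<sigma>: "0 \<le> \<sigma>" "\<sigma> \<le> 1" and r: "r \<le> card V" "m \<le> r"
    and cont: "\<And>B. B \<subseteq> V \<Longrightarrow> P B \<Longrightarrow> card B = m \<Longrightarrow> \<exists>S\<subseteq>B. 2 * card S \<le> m \<and> B \<subseteq> S \<union> C S"
  shows "real (card {R. R \<subseteq> V \<and> card R = r \<and> (\<exists>B\<subseteq>R. card B = m \<and> P B)}) * fact m
    \<le> real (card V choose r) * (2 * \<sigma> * real r) ^ m"
proof -
  define n where "n = card V"
  define X where "X = {B. B \<subseteq> V \<and> card B = m \<and> (\<exists>S\<subseteq>B. 2 * card S \<le> m \<and> B \<subseteq> S \<union> C S)}"
  have finX: "finite X" unfolding X_def by (rule finite_subset[of _ "Pow V"]) (use V in auto)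
  have finR: "finite {R. B \<subseteq> R \<and> R \<subseteq> V \<and> card R = r}" for B
    by (rule finite_subset[of _ "Pow V"]) (use V in auto)
  have "{R. R \<subseteq> V \<and> card R = r \<and> (\<exists>B\<subseteq>R. card B = m \<and> P B)} \<subseteq> (\<Union>B\<in>X. {R. B \<subseteq> R \<and> R \<subseteq> V \<and> card R = r})"
  proof
    fix R assume "R \<in> {R. R \<subseteq> V \<and> card R = r \<and> (\<exists>B\<subseteq>R. card B = m \<and> P B)}"
    then obtain B where B: "R \<subseteq> V" "card R = r" "B \<subseteq> R" "card B = m" "P B" by blast
    then have "B \<subseteq> V" by blast
    from cont[OF this B(5,4)] this B(4) have "B \<in> X" unfolding X_def by blast
    with B show "R \<in> (\<Union>B\<in>X. {R. B \<subseteq> R \<and> R \<subseteq> V \<and> card R = r})" by blast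
  qed
  then have "card {R. R \<subseteq> V \<and> card R = r \<and> (\<exists>B\<subseteq>R. card B = m \<and> P B)} \<le> card (\<Union>B\<in>X. {R. B \<subseteq> R \<and> R \<subseteq> V \<and> card R = r})"
    using finX finR by (intro card_mono finite_UN_I)
  also have "\<dots> \<le> (\<Sum>B\<in>X. card {R. B \<subseteq> R \<and> R \<subseteq> V \<and> card R = r})"
    by (rule card_UN_le[OF finX])
  also have "\<dots> \<le> (\<Sum>B\<in>X. (n - m) choose (r - m))"
  proof (rule sum_mono)
    fix B assume "B \<in> X"
    then have "B \<subseteq> V" "card B = m" unfolding X_def by auto
    then show "card {R. B \<subseteq> R \<and> R \<subseteq> V \<and> card R = r} \<le> (n - m) choose (r - m)"
      using card_supersets_le[OF V, of B r] unfolding n_def by simp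
  qed
  also have "\<dots> = card X * ((n - m) choose (r - m))" by simp
  finally have "real (card {R. R \<subseteq> V \<and> card R = r \<and> (\<exists>B\<subseteq>R. card B = m \<and> P B)}) \<le> real (card X) * real ((n - m) choose (r - m))"
    by (simp only: of_nat_mult[symmetric] of_nat_le_iff)
  then have "real (card {R. R \<subseteq> V \<and> card R = r \<and> (\<exists>B\<subseteq>R. card B = m \<and> P B)}) * fact m
      \<le> real (card X) * real ((n - m) choose (r - m)) * fact m"
    by (rule mult_right_mono) simp
  also have "\<dots> = (real (card X) * fact m) * real ((n - m) choose (r - m))" by simp
  also have "\<dots> \<le> (2 * \<sigma> * real n) ^ m * real ((n - m) choose (r - m))"
    unfolding X_def n_def using V C \<sigma> by (intro mult_right_mono card_contained_le) auto
  also have "\<dots> = (2 * \<sigma>) ^ m * real (((n - m) choose (r - m)) * n ^ m)"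
    by (simp add: power_mult_distrib)
  also have "\<dots> \<le> (2 * \<sigma>) ^ m * real ((n choose r) * r ^ m)"
    using \<sigma> r binomial_superset_ratio_le[of r n m] unfolding n_def
    by (intro mult_left_mono) (simp_all only: of_nat_le_iff, simp)
  also have "\<dots> = real (n choose r) * (2 * \<sigma> * real r) ^ m"
    by (simp add: power_mult_distrib)
  finally show ?thesis unfolding n_def .
qed

section \<open>Failure probability of the random subset\<close>

text \<open>A single term of the exponential series is at most its sum.\<close>

lemma power_le_fact_exp: "real m ^ m \<le> fact m * exp (real m)"
proof -
  have sums: "(\<lambda>n. real m ^ n /\<^sub>R fact n) sums exp (real m)" by (rule exp_converges)
  have "(\<Sum>n\<in>{m}. real m ^ n /\<^sub>R fact n) \<le> (\<Sum>n. real m ^ n /\<^sub>R fact n)"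
    using sums by (intro sum_le_suminf) (auto simp: sums_iff)
  also have "\<dots> = exp (real m)" using sums by (simp add: sums_iff)
  finally have "inverse (fact m) * real m ^ m \<le> exp (real m)" by simp
  then have "fact m * (inverse (fact m) * real m ^ m) \<le> fact m * exp (real m)"
    by (intro mult_left_mono) simp_all
  then show ?thesis by (simp flip: mult.assoc)
qed

text \<open>Shrinking the offending subset to the exact size given by the ceiling lets the union
  bound run over a single cardinality; power freeness is inherited.\<close>

lemma not_power_diff_dense_imp:
  assumes "\<not> power_diff_dense \<delta> k R" "finite R"
  shows "\<exists>B\<subseteq>R. card B = nat \<lceil>\<delta> * real (card R)\<rceil> \<and> power_free k B"
proof -
  obtain B where B: "B \<subseteq> R" "\<delta> * real (card R) \<le> real (card B)" "power_free k B"
    using assms(1) unfolding power_diff_dense_def power_free_def by blast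
  have "nat \<lceil>\<delta> * real (card R)\<rceil> \<le> card B" using B(2) by (simp add: ceiling_le_iff)
  then obtain B' where "B' \<subseteq> B" "card B' = nat \<lceil>\<delta> * real (card R)\<rceil>"
    using obtain_subset_with_card_n by metis
  then show ?thesis using B power_free_subset by (intro exI[of _ B']) blast
qed

text \<open>\<open>deg\<close> feeds the container lemma, the lower bound on \<open>r\<close> keeps
  fingerprints to at most half of \<open>m\<close>, and \<sigma> is small enough for the counting
  bound to become 2^(-m).\<close>

lemma prob_power_diff_dense_ge:
  fixes \<delta> \<sigma> c :: real and k n r :: nat
  assumes \<delta>: "\<delta> > 0" and \<sigma>: "0 \<le> \<sigma>" "\<sigma> \<le> 1" "4 * exp 1 * \<sigma> \<le> \<delta>" and k: "k \<ge> 1" and c: "c > 0"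
    and n: "n > 0" "r \<le> n"
    and deg: "\<And>U. U \<subseteq> {1..int n} \<Longrightarrow> \<sigma>\<^sup>2 * real n \<le> real (card U) \<Longrightarrow>
      \<exists>x\<in>U. c * real n powr (1 / real k) \<le> real (card {y \<in> U. \<exists>d>0. y = x + d ^ k})"
    and r: "2 / (c * \<delta>) * real n powr (1 - 1 / real k) \<le> real r"
  shows "1 - (1 / 2) powr (\<delta> * real r) \<le> measure_pmf.prob (random_subset n r) {R. power_diff_dense \<delta> k R}"
proof -
  define V where "V = {1..int n}"
  define \<Delta> where "\<Delta> = c * real n powr (1 / real k)"
  define m where "m = nat \<lceil>\<delta> * real r\<rceil>"
  define \<Omega> where "\<Omega> = {R. R \<subseteq> V \<and> card R = r}"
  define Bad where "Bad = {R. R \<subseteq> V \<and> card R = r \<and> (\<exists>B\<subseteq>R. card B = m \<and> power_free k B)}"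
  have finV: "finite V" and cV: "card V = n" unfolding V_def by simp_all
  have fin\<Omega>: "finite \<Omega>" unfolding \<Omega>_def by (rule finite_subset[of _ "Pow V"]) (use finV in auto)
  have c\<Omega>: "card \<Omega> = n choose r" unfolding \<Omega>_def using n_subsets[OF finV] cV by simp
  have pos: "real (n choose r) > 0" using n by simp
  have "\<Omega> \<noteq> {}" using c\<Omega> pos by auto
  have Bad\<Omega>: "Bad \<subseteq> \<Omega>" unfolding Bad_def \<Omega>_def by blast
  have "\<Delta> > 0" unfolding \<Delta>_def using c n by simp
  have mr: "\<delta> * real r \<le> real m" unfolding m_def by linarith
  \<comment> \<open>Fingerprints have at most n / \<Delta> elements, so this says that they fill at
    most half of a set of size \<open>m\<close>. Here the exponent 1 - 1/k enters.\<close>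
  have half: "2 * real n \<le> \<Delta> * real m"
  proof -
    have "2 * real n = c * real n powr (1 / real k) * (\<delta> * (2 / (c * \<delta>) * real n powr (1 - 1 / real k)))"
    proof -
      have "real n powr (1 / real k) * real n powr (1 - 1 / real k) = real n"
        using n(1) by (simp flip: powr_add)
      then show ?thesis using c \<delta> by (simp add: field_simps)
    qed
    also have "\<dots> \<le> \<Delta> * (\<delta> * real r)"
      unfolding \<Delta>_def using c \<delta> r by (intro mult_left_mono) auto
    also have "\<dots> \<le> \<Delta> * real m" using mr \<open>\<Delta> > 0\<close> by (intro mult_left_mono) auto
    finally show ?thesis .
  qed
  have "\<exists>C. \<forall>I. I \<subseteq> V \<longrightarrow> (\<forall>x\<in>I. \<forall>y\<in>I. \<not> (\<exists>d>0. y = x + d ^ k)) \<longrightarrow>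
    (\<exists>S\<subseteq>I. real (card S) * \<Delta> \<le> real (card V) \<and> C S \<subseteq> V \<and> real (card (C S)) \<le> \<sigma>\<^sup>2 * real n \<and> I \<subseteq> S \<union> C S)"
  proof (rule container_exists[OF finV \<open>\<Delta> > 0\<close>])
    show "\<not> (\<exists>d>0. x = x + d ^ k)" for x :: int using zero_less_power by auto
    show "\<exists>x\<in>U. \<Delta> \<le> real (card {y \<in> U. \<exists>d>0. y = x + d ^ k})"
      if "U \<subseteq> V" "\<sigma>\<^sup>2 * real n < real (card U)" for U
      unfolding \<Delta>_def using that unfolding V_def by (intro deg) auto
  qed
  then obtain C where C: "\<And>I. I \<subseteq> V \<Longrightarrow> (\<forall>x\<in>I. \<forall>y\<in>I. \<not> (\<exists>d>0. y = x + d ^ k)) \<Longrightarrow>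
    \<exists>S\<subseteq>I. real (card S) * \<Delta> \<le> real (card V) \<and> C S \<subseteq> V \<and> real (card (C S)) \<le> \<sigma>\<^sup>2 * real n \<and> I \<subseteq> S \<union> C S"
    by blast
  \<comment> \<open>The bounds on \<open>C S\<close> are known only for fingerprints; the default
    \<open>{}\<close> extends them to every \<open>S\<close>.\<close>
  define C' where "C' S = (if C S \<subseteq> V \<and> real (card (C S)) \<le> \<sigma>\<^sup>2 * real n then C S else {})" for S
  have C'1: "finite (C' S)" for S unfolding C'_def using finite_subset[OF _ finV] by simp
  have C'2: "real (card (C' S)) \<le> \<sigma>\<^sup>2 * real (card V)" for S unfolding C'_def cV by simp
  have C'3: "\<exists>S\<subseteq>B. 2 * card S \<le> m \<and> B \<subseteq> S \<union> C' S" if B: "B \<subseteq> V" "power_free k B" for B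
  proof -
    have "\<forall>x\<in>B. \<forall>y\<in>B. \<not> (\<exists>d>0. y = x + d ^ k)" using B(2) unfolding power_free_def by blast
    from C[OF B(1) this] obtain S where S: "S \<subseteq> B" "real (card S) * \<Delta> \<le> real (card V)"
      "C S \<subseteq> V" "real (card (C S)) \<le> \<sigma>\<^sup>2 * real n" "B \<subseteq> S \<union> C S" by blast
    have "C' S = C S" unfolding C'_def using S by simp
    moreover have "2 * card S \<le> m"
    proof -
      have "\<Delta> * real (2 * card S) \<le> \<Delta> * real m" using S(2) half unfolding cV by (simp add: mult.commute)
      then have "real (2 * card S) \<le> real m" using \<open>\<Delta> > 0\<close> by (simp only: mult_le_cancel_left_pos)
      then show ?thesis by (simp only: of_nat_le_iff)
    qed
    ultimately show ?thesis using S by (intro exI[of _ S]) simp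
  qed
  have bad: "real (card Bad) \<le> real (n choose r) * (1 / 2) ^ m"
  proof (cases "m \<le> r")
    \<comment> \<open>This is possible only for \<delta> > 1; an \<open>r\<close>-set then has no
      subset of size \<open>m\<close>.\<close>
    case False
    have "Bad = {}"
    proof (rule ccontr)
      assume "Bad \<noteq> {}"
      then obtain R B where "R \<subseteq> V" "card R = r" "B \<subseteq> R" "card B = m" unfolding Bad_def by blast
      then have "m \<le> r" using card_mono[OF finite_subset[OF \<open>R \<subseteq> V\<close> finV] \<open>B \<subseteq> R\<close>] by simp
      with False show False by simp
    qed
    then show ?thesis by simp
  next
    case True
    have "real (card Bad) * fact m \<le> real (card V choose r) * (2 * \<sigma> * real r) ^ m"
      unfolding Bad_def
    proof (rule card_bad_subsets_le[OF finV C'1 C'2 \<sigma>(1,2) _ True])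
      show "r \<le> card V" using n(2) cV by simp
    qed (rule C'3)
    \<comment> \<open>From 4 e \<sigma> <= \<delta> and \<delta> r <= m; the remaining m^m / e^m is
      absorbed by m! below.\<close>
    also have "\<dots> \<le> real (n choose r) * (real m / (2 * exp 1)) ^ m"
    proof -
      have "4 * exp 1 * \<sigma> * real r \<le> \<delta> * real r" using \<sigma>(3) by (intro mult_right_mono) auto
      then have "2 * \<sigma> * real r \<le> real m / (2 * exp 1)" using mr by (simp add: field_simps)
      then show ?thesis unfolding cV using \<sigma>(1) by (intro mult_left_mono power_mono) auto
    qed
    also have "\<dots> = real (n choose r) * ((1 / 2) ^ m * (real m ^ m / exp (real m)))"
      by (simp add: power_divide power_mult_distrib flip: exp_of_nat_mult)
    also have "\<dots> \<le> real (n choose r) * ((1 / 2) ^ m * fact m)"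
      using power_le_fact_exp[of m] by (intro mult_left_mono) (auto simp: divide_le_eq)
    finally have "real (card Bad) * fact m \<le> (real (n choose r) * (1 / 2) ^ m) * fact m"
      by (simp only: mult.assoc)
    then show ?thesis by (rule mult_right_le_imp_le) simp
  qed
  have "\<Omega> - Bad \<subseteq> \<Omega> \<inter> {R. power_diff_dense \<delta> k R}"
  proof
    fix R assume R: "R \<in> \<Omega> - Bad"
    then have "R \<subseteq> V" "card R = r" unfolding \<Omega>_def by auto
    moreover have "finite R" by (rule finite_subset[OF \<open>R \<subseteq> V\<close> finV])
    ultimately show "R \<in> \<Omega> \<inter> {R. power_diff_dense \<delta> k R}"
      using R not_power_diff_dense_imp[of \<delta> k R] unfolding Bad_def m_def by blast
  qed
  then have "card (\<Omega> - Bad) \<le> card (\<Omega> \<inter> {R. power_diff_dense \<delta> k R})"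
    using fin\<Omega> by (intro card_mono) auto
  then have "real (card \<Omega>) - real (card Bad) \<le> real (card (\<Omega> \<inter> {R. power_diff_dense \<delta> k R}))"
    using card_Diff_subset[OF finite_subset[OF Bad\<Omega> fin\<Omega>] Bad\<Omega>] card_mono[OF fin\<Omega> Bad\<Omega>] by linarith
  then have "real (n choose r) * (1 - (1 / 2) ^ m) \<le> real (card (\<Omega> \<inter> {R. power_diff_dense \<delta> k R}))"
    using bad unfolding c\<Omega> by (simp add: algebra_simps)
  then have "1 - (1 / 2) ^ m \<le> real (card (\<Omega> \<inter> {R. power_diff_dense \<delta> k R})) / real (card \<Omega>)"
    unfolding c\<Omega> using pos by (simp add: pos_le_divide_eq mult.commute)
  also have "\<dots> = measure_pmf.prob (random_subset n r) {R. power_diff_dense \<delta> k R}"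
    unfolding random_subset_def V_def[symmetric] \<Omega>_def[symmetric]
    using measure_pmf_of_set[OF \<open>\<Omega> \<noteq> {}\<close> fin\<Omega>] by simp
  finally have *: "1 - (1 / 2) ^ m \<le> measure_pmf.prob (random_subset n r) {R. power_diff_dense \<delta> k R}" .
  have "(1 / 2 :: real) ^ m = (1 / 2) powr real m" by (simp add: powr_realpow)
  also have "\<dots> \<le> (1 / 2) powr (\<delta> * real r)" using mr by (intro powr_mono') auto
  finally show ?thesis using * by linarith
qed

theorem mainTheorem1:
  fixes k :: nat and \<delta> :: real
  assumes "k \<ge> 2" and "\<delta> > 0"
  shows "\<exists>C::real. C > 0 \<and>
    (\<forall>r :: nat \<Rightarrow> nat.
      (\<forall>\<^sub>F n in sequentially.
         C * real n powr (1 - 1 / real k) \<le> real (r n) \<and> r n \<le> n) \<longrightarrow>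
      ((\<lambda>n. measure_pmf.prob (random_subset n (r n)) {R. power_diff_dense \<delta> k R})
         \<longlonglongrightarrow> 1))"
proof -
  \<comment> \<open>\<sigma> depends on \<delta> only, so the constants drawn from supersaturation
    depend on \<delta> and \<open>k\<close> only.\<close>
  define \<sigma> where "\<sigma> = min 1 (\<delta> / (4 * exp 1))"
  have \<sigma>: "0 < \<sigma>" "\<sigma> \<le> 1" "4 * exp 1 * \<sigma> \<le> \<delta>"
  proof -
    show "0 < \<sigma>" "\<sigma> \<le> 1" unfolding \<sigma>_def using \<open>\<delta> > 0\<close> by auto
    have "4 * exp 1 * \<sigma> \<le> 4 * exp 1 * (\<delta> / (4 * exp 1))"
      unfolding \<sigma>_def by (intro mult_left_mono) auto
    then show "4 * exp 1 * \<sigma> \<le> \<delta>" by simp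
  qed
  have k1: "k \<ge> 1" using \<open>k \<ge> 2\<close> by simp
  have "\<sigma>\<^sup>2 > 0" using \<sigma> by simp
  from power_supersaturation[OF k1 this] obtain c n\<^sub>0 where c: "c > 0" and
    deg: "\<And>n U. n \<ge> n\<^sub>0 \<Longrightarrow> U \<subseteq> {1..int n} \<Longrightarrow> \<sigma>\<^sup>2 * real n \<le> real (card U) \<Longrightarrow>
      \<exists>x\<in>U. c * real n powr (1 / real k) \<le> real (card {y \<in> U. \<exists>d>0. y = x + d ^ k})" by blast
  define C where "C = 2 / (c * \<delta>)"
  have "C > 0" unfolding C_def using c \<open>\<delta> > 0\<close> by simp
  moreover have "(\<lambda>n. measure_pmf.prob (random_subset n (r n)) {R. power_diff_dense \<delta> k R}) \<longlonglongrightarrow> 1"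
    if r: "\<forall>\<^sub>F n in sequentially. C * real n powr (1 - 1 / real k) \<le> real (r n) \<and> r n \<le> n" for r
  proof -
    define a where "a = 1 - 1 / real k"
    \<comment> \<open>Here k >= 2 is essential: a positive exponent makes the failure bound
      2^(-\<delta> C n^a) tend to 0.\<close>
    have "a > 0" unfolding a_def using \<open>k \<ge> 2\<close> by simp
    have "\<delta> * C > 0" using \<open>C > 0\<close> \<open>\<delta> > 0\<close> by simp
    have "filterlim (\<lambda>n. real n powr a) at_top sequentially"
      using \<open>a > 0\<close> by real_asymp
    then have "filterlim (\<lambda>n. (\<delta> * C) * real n powr a) at_top sequentially"
      using \<open>\<delta> * C > 0\<close> by (rule filterlim_tendsto_pos_mult_at_top[OF tendsto_const, rotated])
    moreover have "((\<lambda>x. 1 - (1 / 2) powr x) \<longlongrightarrow> (1 :: real)) at_top" by real_asymp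
    ultimately have lim: "(\<lambda>n. 1 - (1 / 2) powr ((\<delta> * C) * real n powr a)) \<longlonglongrightarrow> (1 :: real)"
      by (rule filterlim_compose[rotated])
    show ?thesis
    proof (rule tendsto_sandwich[OF _ _ lim tendsto_const])
      show "\<forall>\<^sub>F n in sequentially. 1 - (1 / 2) powr ((\<delta> * C) * real n powr a)
          \<le> measure_pmf.prob (random_subset n (r n)) {R. power_diff_dense \<delta> k R}"
        using r eventually_ge_at_top[of "max 1 n\<^sub>0"]
      proof eventually_elim
        case (elim n)
        have "(1 / 2 :: real) powr (\<delta> * real (r n)) \<le> (1 / 2) powr ((\<delta> * C) * real n powr a)"
          using elim(1) \<open>\<delta> > 0\<close> unfolding a_def by (intro powr_mono') (auto simp: mult.assoc)
        moreover have "1 - (1 / 2) powr (\<delta> * real (r n))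
            \<le> measure_pmf.prob (random_subset n (r n)) {R. power_diff_dense \<delta> k R}"
          using elim \<sigma> c \<open>\<delta> > 0\<close> k1 deg unfolding C_def by (intro prob_power_diff_dense_ge[of \<delta> \<sigma> k c]) auto
        ultimately show ?case by linarith
      qed
    qed (simp add: measure_pmf.prob_le_1)
  qed
  ultimately show ?thesis by blast
qed

end
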